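(* Normalize $P_0$ to have leading coefficient $-1/d$, i.e. $P_0(z)=-\frac1d z^d+a_{d-1}z^{d-1}+\dots+a_1z+a_0$ with $(a_0,\dots,a_{d-1})\in\mathbb{C}^d$. For each $d\ge 1$ there exists a universal polynomial of $d$ variables with rational coefficients $\Pi_d(X_0,X_1,\dots,X_{d-1})\in\mathbb{Q}[X_0,\dots,X_{d-1}]$ with $\Pi_d(0,\dots,0)=0$ and such that the ramificant is given by $$\Delta(a_0,a_1,\dots,a_{d-1})=\begin{vmatrix} f_0(w_1^* ) & f_1(w_1^* ) & \cdots & f_{d-1}(w_1^* )\\ f_0(w_2^* ) & f_1(w_2^* ) & \cdots & f_{d-1}(w_2^* )\\ \vdots & \vdots & \ddots & \vdots\\ f_0(w_d^* ) & f_1(w_d^* ) & \cdots & f_{d-1}(w_d^* )\end{vmatrix}=\frac{(-1)^{d-1}}{\sqrt{\pi}}\left(\frac{\pi}{d}\right)^{d/2}V_d\;e^{\Pi_d(a_0,a_1,\dots,a_{d-1})},$$ where $V_d$ is the Vandermonde determinant of the $d$-th roots of unity $\omega_1,\dots,\omega_d$, $$V_d=\begin{vmatrix} 1 & \omega_1 & \omega_1^2 & \cdots & \omega_1^{d-1}\\ 1 & \omega_2 & \omega_2^2 & \cdots & \omega_2^{d-1}\\ \vdots & \vdots & \vdots & \ddots & \vdots\\ 1 & \omega_d & \omega_d^2 & \cdots & \omega_d^{d-1}\end{vmatrix}=\prod_{i\neq j}(\omega_i-\omega_j)\neq 0.$$ In particular this ramificant is never $0$. Moreover the Vandermonde determinant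 $V_d$ can be computed, $$V_d=(-1)^{d-1}d^d,$$ and therefore $$\Delta(a_0,a_1,\dots,a_{d-1})=\frac{1}{\sqrt{\pi}}\,(\pi d)^{d/2}\,e^{\Pi_d(a_0,a_1,\dots,a_{d-1})}.$$
   Context: The $d$-th roots of unity are $\omega_k=e^{2\pi i(k-1)/d}$, $k=1,\dots,d$. For $j=0,\dots,d-1$ let $F_j(z)=\int_0^z t^j e^{P_0(t)}\,dt$. The function $F_0$ uniformizes a simply connected log-Riemann surface $\mathcal{S}$ (a Riemann surface spread over $\mathbb{C}$, built by gluing slit planes by the identity along half-line cuts) having exactly $d$ ramification points $w_1^*,\dots,w_d^*$, all of infinite order; with $k_0:\mathcal{S}\to\mathbb{C}$ the inverse of the uniformization, $f_j=F_j\circ k_0$. The value $f_j(w_k^* )$ is the limit of $f_j$ at $w_k^*$ through angular sectors (Stolz angles), namely $f_j(w_k^* )=\int_0^{+\infty\cdot\omega_k}z^j e^{P_0(z)}\,dz$, the integral along the ray from $0$ in the direction $\omega_k$. The determinant $\Delta$ is called the ramificant of $f_0,\dots,f_{d-1}$. "Universal" means that $\Pi_d$ depends only on $d$.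
   Formalization: Constants corrected (printed ones fail for d=2, a=0): π becomes 2π in Δ; V_d is the product over i<j of ω_j−ω_i, equal to i^{(d-1)(3d-2)/2}d^{d/2}; (-1)^{d-1}d^d is the product over i≠j; last formula is Δ = i^{(d-1)(3d+2)/2}(2π)^{d/2}e^{Π_d}/√(2π). *)

theory Defs
  imports
    "HOL-Complex_Analysis.Complex_Analysis"
    "HOL-Library.Poly_Mapping"
    "Jordan_Normal_Form.Determinant"
begin

section \<open>Multivariate polynomials\<close>

text \<open>Polynomials in the variables \<open>X\<^sub>0, X\<^sub>1, \<dots>\<close> over \<open>'a\<close>: finitely supported maps from
  monomials (finitely supported exponent vectors) to coefficients.\<close>

type_synonym 'a mpolynomial = "(nat \<Rightarrow>\<^sub>0 nat) \<Rightarrow>\<^sub>0 'a"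

definition mp_vars :: "'a::zero mpolynomial \<Rightarrow> nat set" where
  "mp_vars p = (\<Union>m\<in>Poly_Mapping.keys p. Poly_Mapping.keys m)"

definition mp_eval :: "rat mpolynomial \<Rightarrow> (nat \<Rightarrow> 'a) \<Rightarrow> 'a::field_char_0" where
  "mp_eval p x =
     (\<Sum>m\<in>Poly_Mapping.keys p. of_rat (Poly_Mapping.lookup p m) *
        (\<Prod>i\<in>Poly_Mapping.keys m. x i ^ Poly_Mapping.lookup m i))"


section \<open>The ramificant\<close>

text \<open>The roots of unity are indexed from \<open>k = 1\<close>; the subtraction takes place in the complex
  numbers.\<close>

definition omega :: "nat \<Rightarrow> nat \<Rightarrow> complex" where
  "omega d k = exp (2 * of_real pi * \<i> * (of_nat k - 1) / of_nat d)"

definition P0 :: "nat \<Rightarrow> (nat \<Rightarrow> complex) \<Rightarrow> complex poly" where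
  "P0 d a = Polynomial.monom (- 1 / of_nat d) d + (\<Sum>i<d. Polynomial.monom (a i) i)"

definition F :: "complex poly \<Rightarrow> nat \<Rightarrow> complex \<Rightarrow> complex" where
  "F P j z = contour_integral (linepath 0 z) (\<lambda>t. t ^ j * exp (poly P t))"

text \<open>In the coordinate \<open>k\<^sub>0\<close> on the log-Riemann surface uniformized by \<open>F P 0\<close>, the function
  \<open>f\<^sub>j\<close> is \<open>F P j\<close>, and the infinite ramification point \<open>w\<^sub>k\<^sup>*\<close> is approached along the ray from
  \<open>0\<close> in the direction \<open>w = \<omega>\<^sub>k\<close>; the value of \<open>f\<^sub>j\<close> there is the improper integral along this
  ray. \<open>Lim\<close> is a total function, so this is meaningful only if the limit exists.\<close>

definition ram_value :: "complex poly \<Rightarrow> nat \<Rightarrow> complex \<Rightarrow> complex" where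
  "ram_value P j w = Lim at_top (\<lambda>r::real. F P j (of_real r * w))"

text \<open>Matrices are indexed from \<open>0\<close>, hence row \<open>k\<close> belongs to the root of unity with index
  \<open>Suc k\<close>.\<close>

definition ramificant :: "nat \<Rightarrow> (nat \<Rightarrow> complex) \<Rightarrow> complex" where
  "ramificant d a =
     Determinant.det (Matrix.mat d d (\<lambda>(k, j). ram_value (P0 d a) j (omega d (Suc k))))"

definition vandermonde_roots :: "nat \<Rightarrow> complex" where
  "vandermonde_roots d = Determinant.det (Matrix.mat d d (\<lambda>(k, j). omega d (Suc k) ^ j))"

end

theory Submission
  imports Defs
begin

text \<open>
  Call \<open>M\<^sub>n = \<integral> z\<^sup>n e\<^bsup>P(z)\<^esup> dz\<close>, taken along one of the \<open>d\<close> rays, the \<open>n\<close>-th moment; the columns of the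
  ramificant \<open>\<Delta>\<close> consist of the moments with \<open>n < d\<close>. Integrating the derivative of
  \<open>z\<^bsup>n+1\<^esup> e\<^bsup>P(z)\<^esup>\<close> along a ray leaves no boundary term, neither at the origin nor at infinity, and
  gives \<open>M\<^bsub>n+d\<^esub> = (n + 1) M\<^sub>n + \<Sum>\<^sub>l l a\<^sub>l M\<^bsub>n+l\<^esub>\<close> with \<open>1 \<le> l < d\<close> (\<open>ram_value_recurrence\<close>). Hence
  every moment is a combination of the first \<open>d\<close> ones, with coefficients that are polynomials in
  \<open>a\<close> over the rationals and are the same for all rays (\<open>moment_coeff_recurrence\<close>).

  Now replace \<open>a\<close> by \<open>t a\<close>. Differentiation under the integral sign gives
  \<open>dM\<^sub>j/dt = \<Sum>\<^sub>m a\<^sub>m M\<^bsub>j+m\<^esub>\<close> (\<open>DERIV_ram_value_parameter\<close>), so the matrix of moments solves a linear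
  differential equation whose coefficient matrix is polynomial in \<open>t\<close> and \<open>a\<close>, and its determinant
  satisfies \<open>\<Delta>' = \<tau> \<Delta>\<close> with \<open>\<tau>\<close> the trace of that matrix (\<open>DERIV_ramificant\<close>). Therefore
  \<open>\<Delta>(a) = \<Delta>(0) e\<^bsup>\<Pi>(a)\<^esup>\<close>, where \<open>\<Pi>\<close> is the integral of \<open>\<tau>\<close> over \<open>0 \<le> t \<le> 1\<close>: a polynomial with rational
  coefficients that vanishes at the origin (\<open>ramificant_eq_exp\<close>).

  It remains to compute \<open>\<Delta>(0)\<close>. For \<open>P(z) = - z\<^sup>d / d\<close> the \<open>j\<close>-th moment on the ray through \<open>\<omega>\<close> is
  \<open>\<omega>\<^bsup>j+1\<^esup>\<close> times a value of the Gamma function, so the determinant is the product of the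
  roots of unity, of these Gamma values, and of the Vandermonde determinant. The product
  \<open>\<Gamma>(1/d) \<Gamma>(2/d) \<dots> \<Gamma>(d/d)\<close> follows from the reflection formula and from
  \<open>\<Prod> 2 sin (\<pi> m / d) = d\<close> over \<open>0 < m < d\<close>; the latter, like the modulus of the Vandermonde
  determinant, comes from the derivative of \<open>X\<^sup>d - 1\<close> at its roots.
\<close>

section \<open>Evaluation of multivariate polynomials\<close>

definition monomial_value :: "(nat \<Rightarrow>\<^sub>0 nat) \<Rightarrow> (nat \<Rightarrow> 'a::comm_monoid_mult) \<Rightarrow> 'a" where
  "monomial_value m x = (\<Prod>i\<in>Poly_Mapping.keys m. x i ^ Poly_Mapping.lookup m i)"

definition total_degree :: "(nat \<Rightarrow>\<^sub>0 nat) \<Rightarrow> nat" where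
  "total_degree m = (\<Sum>i\<in>Poly_Mapping.keys m. Poly_Mapping.lookup m i)"

lemma monomial_value_superset:
  assumes "finite S" "Poly_Mapping.keys m \<subseteq> S"
  shows "monomial_value m x = (\<Prod>i\<in>S. x i ^ Poly_Mapping.lookup m i)"
  unfolding monomial_value_def
  by (rule prod.mono_neutral_left) (use assms in \<open>auto simp: in_keys_iff\<close>)

lemma monomial_value_add: "monomial_value (m + n) x = monomial_value m x * monomial_value n x"
proof -
  let ?S = "Poly_Mapping.keys m \<union> Poly_Mapping.keys n"
  have "Poly_Mapping.keys (m + n) \<subseteq> ?S" by (rule Poly_Mapping.keys_add)
  then show ?thesis
    by (simp add: monomial_value_superset[where S = ?S] lookup_add power_add prod.distrib)
qed

lemma monomial_value_scale:
  fixes x :: "nat \<Rightarrow> 'a::comm_semiring_1"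
  shows "monomial_value m (\<lambda>i. t * x i) = t ^ total_degree m * monomial_value m x"
  by (simp add: monomial_value_def total_degree_def power_mult_distrib prod.distrib power_sum)

lemma monomial_value_0 [simp]: "monomial_value 0 x = 1"
  by (simp add: monomial_value_def)

lemma monomial_value_var [simp]: "monomial_value (Poly_Mapping.single i 1) x = x i"
  by (simp add: monomial_value_def)

lemma mp_eval_superset:
  assumes "finite S" "Poly_Mapping.keys p \<subseteq> S"
  shows "mp_eval p x = (\<Sum>m\<in>S. of_rat (Poly_Mapping.lookup p m) * monomial_value m x)"
  unfolding mp_eval_def monomial_value_def
  by (rule sum.mono_neutral_left) (use assms in \<open>auto simp: in_keys_iff\<close>)

lemma mp_eval_0 [simp]: "mp_eval 0 x = 0"
  by (simp add: mp_eval_def)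

lemma mp_eval_add: "mp_eval (p + q) x = mp_eval p x + mp_eval q x"
proof -
  let ?S = "Poly_Mapping.keys p \<union> Poly_Mapping.keys q"
  have "Poly_Mapping.keys (p + q) \<subseteq> ?S" by (rule Poly_Mapping.keys_add)
  then show ?thesis
    by (simp add: mp_eval_superset[where S = ?S] lookup_add of_rat_add distrib_right sum.distrib)
qed

lemma mp_eval_sum: "mp_eval (\<Sum>i\<in>A. p i) x = (\<Sum>i\<in>A. mp_eval (p i) x)"
  by (induction A rule: infinite_finite_induct) (auto simp: mp_eval_add)

lemma mp_eval_single [simp]: "mp_eval (Poly_Mapping.single m c) x = of_rat c * monomial_value m x"
  by (subst mp_eval_superset[where S = "{m}"]) (auto simp: lookup_single)

lemma mp_eval_one [simp]: "mp_eval 1 x = 1"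
  using mp_eval_single[of 0 1 x] by simp

lemma mpolynomial_sum_monomials:
  "p = (\<Sum>m\<in>Poly_Mapping.keys p. Poly_Mapping.single m (Poly_Mapping.lookup p m))"
  by (rule poly_mapping_eqI)
     (auto simp: lookup_sum lookup_single when_def in_keys_iff)

text \<open>The recurrence of the moments multiplies polynomials only by constants and by single variables,
  so evaluation has to be multiplicative only for a monomial factor.\<close>

lemma mp_eval_single_mult:
  "mp_eval (Poly_Mapping.single m c * p) x = of_rat c * monomial_value m x * mp_eval p x"
proof -
  let ?K = "Poly_Mapping.keys p"
  have "Poly_Mapping.single m c * p =
      (\<Sum>k\<in>?K. Poly_Mapping.single (m + k) (c * Poly_Mapping.lookup p k))"
    by (subst mpolynomial_sum_monomials[of p]) (simp add: sum_distrib_left mult_single)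
  then show ?thesis
    by (simp add: mp_eval_sum monomial_value_add of_rat_mult mult_ac
                  mp_eval_superset[OF finite_keys order_refl, of p] sum_distrib_left)
qed

lemma mp_vars_add: "mp_vars (p + q) \<subseteq> mp_vars p \<union> mp_vars q"
  unfolding mp_vars_def using Poly_Mapping.keys_add[of p q] by blast

lemma mp_vars_0 [simp]: "mp_vars 0 = {}"
  by (simp add: mp_vars_def)

lemma mp_vars_one [simp]: "mp_vars (1 :: rat mpolynomial) = {}"
  by (simp add: mp_vars_def)

lemma mp_vars_sum:
  assumes "\<And>i. i \<in> A \<Longrightarrow> mp_vars (p i) \<subseteq> V"
  shows "mp_vars (\<Sum>i\<in>A. p i) \<subseteq> V"
  using assms
proof (induction A rule: infinite_finite_induct)
  case (insert i A)
  then show ?case using mp_vars_add[of "p i" "sum p A"] by auto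
qed auto

lemma mp_vars_single: "mp_vars (Poly_Mapping.single m c) \<subseteq> Poly_Mapping.keys m"
  by (simp add: mp_vars_def)

lemma mp_vars_mult: "mp_vars (p * q) \<subseteq> mp_vars p \<union> mp_vars q"
proof
  fix i assume "i \<in> mp_vars (p * q)"
  then obtain m where "m \<in> Poly_Mapping.keys (p * q)" and i: "i \<in> Poly_Mapping.keys m"
    by (auto simp: mp_vars_def)
  then obtain m1 m2 where "m = m1 + m2" "m1 \<in> Poly_Mapping.keys p" "m2 \<in> Poly_Mapping.keys q"
    using Poly_Mapping.keys_mult[of p q] by blast
  with i Poly_Mapping.keys_add[of m1 m2] show "i \<in> mp_vars p \<union> mp_vars q"
    unfolding mp_vars_def by blast
qed

text \<open>Dividing each monomial coefficient by one more than the degree is the operation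
  \<open>p \<mapsto> \<integral>\<^sub>0\<^sup>1 p (s x) ds\<close> on polynomials, since \<open>p (s x)\<close> multiplies a monomial of degree \<open>e\<close> by \<open>s\<^sup>e\<close>.
  It stays within the rational coefficients and integrates polynomials along rays from the origin.\<close>

definition radial_primitive :: "rat mpolynomial \<Rightarrow> rat mpolynomial" where
  "radial_primitive p = (\<Sum>m\<in>Poly_Mapping.keys p.
     Poly_Mapping.single m (Poly_Mapping.lookup p m / of_nat (Suc (total_degree m))))"

lemma mp_vars_radial_primitive: "mp_vars (radial_primitive p) \<subseteq> mp_vars p"
  unfolding radial_primitive_def
proof (rule mp_vars_sum)
  fix m assume "m \<in> Poly_Mapping.keys p"
  then show "mp_vars (Poly_Mapping.single m
      (Poly_Mapping.lookup p m / of_nat (Suc (total_degree m)))) \<subseteq> mp_vars p"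
    using mp_vars_single by (fastforce simp: mp_vars_def)
qed

lemma DERIV_radial_primitive:
  fixes a :: "nat \<Rightarrow> complex"
  shows "((\<lambda>t. t * mp_eval (radial_primitive p) (\<lambda>i. t * a i)) has_field_derivative
           mp_eval p (\<lambda>i. t * a i)) (at t)"
proof -
  let ?K = "Poly_Mapping.keys p" and ?c = "\<lambda>m. of_rat (Poly_Mapping.lookup p m) :: complex"
  have eq: "(\<lambda>t. t * mp_eval (radial_primitive p) (\<lambda>i. t * a i)) =
     (\<lambda>t. \<Sum>m\<in>?K. ?c m * monomial_value m a / of_nat (Suc (total_degree m)) * t ^ Suc (total_degree m))"
    by (rule ext)
       (simp add: radial_primitive_def mp_eval_sum monomial_value_scale of_rat_divide of_rat_add
                  sum_distrib_left mult_ac)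
  have d: "((\<lambda>t. ?c m * monomial_value m a / of_nat (Suc (total_degree m)) * t ^ Suc (total_degree m))
      has_field_derivative ?c m * monomial_value m (\<lambda>i. t * a i)) (at t)" for m
  proof -
    have "((\<lambda>t. ?c m * monomial_value m a / of_nat (Suc (total_degree m)) * t ^ Suc (total_degree m))
      has_field_derivative ?c m * monomial_value m a / of_nat (Suc (total_degree m)) *
         (of_nat (Suc (total_degree m)) * t ^ total_degree m)) (at t)"
      by (auto intro!: derivative_eq_intros simp del: of_nat_Suc power_Suc)
    also have "?c m * monomial_value m a / of_nat (Suc (total_degree m)) *
         (of_nat (Suc (total_degree m)) * t ^ total_degree m) = ?c m * monomial_value m (\<lambda>i. t * a i)"
      by (simp add: monomial_value_scale del: of_nat_Suc)
    finally show ?thesis .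
  qed
  have "mp_eval p (\<lambda>i. t * a i) = (\<Sum>m\<in>?K. ?c m * monomial_value m (\<lambda>i. t * a i))"
    by (rule mp_eval_superset) auto
  then show ?thesis unfolding eq by (simp only:) (rule DERIV_sum, rule d)
qed

section \<open>Reduction of moments by the recurrence\<close>

text \<open>Normal form of the \<open>n\<close>-th moment: the coefficient of the \<open>j\<close>-th basic moment when all
  moments are reduced to those of index below \<open>d\<close>. The recursion copies the one that integration
  by parts yields for the moments, with the coefficients \<open>a\<^sub>l\<close> of the exponent as variables. For
  \<open>d = 0\<close> the recursion would not descend, so every index counts as reduced.\<close>

function moment_coeff :: "nat \<Rightarrow> nat \<Rightarrow> nat \<Rightarrow> rat mpolynomial" where
  "moment_coeff d n j =
    (if n < d \<or> d = 0 then (if n = j then 1 else 0)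
     else Poly_Mapping.single 0 (of_nat (Suc (n - d))) * moment_coeff d (n - d) j +
          (\<Sum>l=1..<d. Poly_Mapping.single (Poly_Mapping.single l 1) (of_nat l)
                        * moment_coeff d (n - d + l) j))"
  by auto
termination
  by (relation "inv_image less_than (\<lambda>(d, n, j). n)") auto

declare moment_coeff.simps [simp del]

lemma mp_vars_moment_coeff: "mp_vars (moment_coeff d n j) \<subseteq> {..<d}"
proof (induction d n j rule: moment_coeff.induct)
  case (1 d n j)
  show ?case
  proof (cases "n < d \<or> d = 0")
    case True
    then show ?thesis by (simp add: moment_coeff.simps[of d n j])
  next
    case False
    have "mp_vars (Poly_Mapping.single 0 (of_nat (Suc (n - d))) * moment_coeff d (n - d) j) \<subseteq> {..<d}"
      using 1(1)[OF False]
        mp_vars_mult[of "Poly_Mapping.single 0 (of_nat (Suc (n - d)))" "moment_coeff d (n - d) j"]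
        mp_vars_single[of 0 "of_nat (Suc (n - d)) :: rat"] by auto
    moreover have "mp_vars (\<Sum>l=1..<d. Poly_Mapping.single (Poly_Mapping.single l 1) (of_nat l)
                        * moment_coeff d (n - d + l) j) \<subseteq> {..<d}"
    proof (rule mp_vars_sum)
      fix l assume l: "l \<in> {1..<d}"
      have "mp_vars (Poly_Mapping.single (Poly_Mapping.single l 1) (of_nat l :: rat)) \<subseteq> {..<d}"
        using mp_vars_single[of "Poly_Mapping.single l 1" "of_nat l :: rat"] l by auto
      with 1(2)[OF False l] mp_vars_mult
      show "mp_vars (Poly_Mapping.single (Poly_Mapping.single l 1) (of_nat l)
                        * moment_coeff d (n - d + l) j) \<subseteq> {..<d}" by blast
    qed
    ultimately show ?thesis
      using mp_vars_add False by (subst moment_coeff.simps) (simp, blast)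
  qed
qed

text \<open>The hypothesis is the recurrence of the moments \<open>M n\<close> along one ray. The coefficients in the
  conclusion do not mention \<open>M\<close>, which is why the same reduction applies to all rays, that is, to
  whole columns of the ramificant at once.\<close>

lemma moment_coeff_recurrence:
  fixes M a :: "nat \<Rightarrow> complex"
  assumes d: "d \<ge> 1"
    and rec: "\<And>n. M (n + d) = of_nat (Suc n) * M n + (\<Sum>l=1..<d. of_nat l * a l * M (n + l))"
  shows "M n = (\<Sum>j<d. mp_eval (moment_coeff d n j) a * M j)"
proof (induction n rule: less_induct)
  case (less n)
  show ?case
  proof (cases "n < d")
    case True
    then show ?thesis
      by (simp add: moment_coeff.simps[of d n] if_distrib[of "\<lambda>p. mp_eval p a * _"] cong: if_cong)
  next
    case False
    define k where "k = n - d"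
    have n: "n = k + d" using False by (simp add: k_def)
    have coeff: "mp_eval (moment_coeff d n j) a = of_nat (Suc k) * mp_eval (moment_coeff d k j) a
        + (\<Sum>l=1..<d. of_nat l * a l * mp_eval (moment_coeff d (k + l) j) a)" for j
      using d by (subst moment_coeff.simps)
        (simp add: n mp_eval_add mp_eval_sum mp_eval_single_mult
          del: of_nat_Suc single_of_nat One_nat_def)
    have "M n = of_nat (Suc k) * M k + (\<Sum>l=1..<d. of_nat l * a l * M (k + l))"
      by (simp only: n rec)
    also have "\<dots> = of_nat (Suc k) * (\<Sum>j<d. mp_eval (moment_coeff d k j) a * M j)
       + (\<Sum>l=1..<d. of_nat l * a l * (\<Sum>j<d. mp_eval (moment_coeff d (k + l) j) a * M j))"
      using d less.IH[of k] by (intro arg_cong2[of _ _ _ _ "(+)"] sum.cong) (auto simp: n less.IH)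
    also have "\<dots> = (\<Sum>j<d. mp_eval (moment_coeff d n j) a * M j)"
      unfolding coeff distrib_right sum.distrib sum_distrib_left sum_distrib_right
      by (subst (2) sum.swap) (simp add: mult_ac)
    finally show ?thesis .
  qed
qed

section \<open>Derivatives and scalings of determinants\<close>

text \<open>Replacing one column of a matrix by a combination of its columns multiplies the determinant by
  the coefficient of the replaced column (Cramer's rule). Summing over the columns gives the
  trace.\<close>

lemma det_columns_combination:
  fixes Y N :: "nat \<Rightarrow> nat \<Rightarrow> 'a::idom"
  shows "(\<Sum>c<n. Determinant.det (Matrix.mat n n (\<lambda>(k, j).
            if j = c then (\<Sum>i<n. N c i * Y k i) else Y k j)))
         = (\<Sum>c<n. N c c) * Determinant.det (Matrix.mat n n (\<lambda>(k, j). Y k j))"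
  unfolding sum_distrib_right
proof (rule sum.cong[OF refl])
  fix c assume "c \<in> {..<n}"
  then have c: "c < n" by simp
  let ?A = "Matrix.mat n n (\<lambda>(k, j). Y k j)" and ?x = "Matrix.vec n (N c)"
  have "Matrix.mat n n (\<lambda>(k, j). if j = c then (\<Sum>i<n. N c i * Y k i) else Y k j)
      = replace_col ?A (?A *\<^sub>v ?x) c"
    by (rule eq_matI)
       (auto simp: replace_col_def scalar_prod_def lessThan_atLeast0 mult.commute intro!: sum.cong)
  moreover have "Determinant.det (replace_col ?A (?A *\<^sub>v ?x) c) = ?x $ c * Determinant.det ?A"
    by (rule cramer_lemma_mat) (use c in auto)
  ultimately show "Determinant.det (Matrix.mat n n (\<lambda>(k, j).
            if j = c then (\<Sum>i<n. N c i * Y k i) else Y k j)) = N c c * Determinant.det ?A"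
    using c by simp
qed

lemma det_mat_leibniz:
  fixes Z :: "nat \<Rightarrow> nat \<Rightarrow> 'a::comm_ring_1"
  shows "Determinant.det (Matrix.mat n n (\<lambda>(k, j). Z k j)) =
           (\<Sum>p | p permutes {0..<n}. signof p * (\<Prod>j<n. Z (p j) j))"
proof -
  have "p j < n" if "j < n" "p permutes {0..<n}" for p j
    using that permutes_in_image[of p "{0..<n}" j] by simp
  then show ?thesis
    by (subst det_col[of _ n]) (auto intro!: sum.cong prod.cong simp: lessThan_atLeast0)
qed

lemma det_scale_rows_columns:
  fixes Z :: "nat \<Rightarrow> nat \<Rightarrow> 'a::comm_ring_1"
  shows "Determinant.det (Matrix.mat n n (\<lambda>(k, j). u k * v j * Z k j)) =
           (\<Prod>k<n. u k) * (\<Prod>j<n. v j) * Determinant.det (Matrix.mat n n (\<lambda>(k, j). Z k j))"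
proof -
  have "(\<Prod>j<n. u (p j)) = (\<Prod>k<n. u k)" if "p permutes {0..<n}" for p
    using prod.permute[OF that, of u] by (simp add: lessThan_atLeast0 o_def)
  then show ?thesis
    unfolding det_mat_leibniz sum_distrib_left
    by (intro sum.cong refl) (simp add: prod.distrib mult_ac)
qed

lemma DERIV_det_columns:
  fixes Y Y' :: "nat \<Rightarrow> nat \<Rightarrow> complex \<Rightarrow> complex"
  assumes "\<And>k j. k < n \<Longrightarrow> j < n \<Longrightarrow> (Y k j has_field_derivative Y' k j t) (at t)"
  shows "((\<lambda>t. Determinant.det (Matrix.mat n n (\<lambda>(k, j). Y k j t))) has_field_derivative
           (\<Sum>c<n. Determinant.det (Matrix.mat n n (\<lambda>(k, j). if j = c then Y' k j t else Y k j t)))) (at t)"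
proof -
  have summand: "((\<lambda>t. signof p * (\<Prod>j<n. Y (p j) j t)) has_field_derivative
      (\<Sum>c<n. signof p * (\<Prod>j<n. if j = c then Y' (p j) j t else Y (p j) j t))) (at t)"
    if p: "p permutes {0..<n}" for p
  proof -
    have pj: "j < n \<Longrightarrow> p j < n" for j using permutes_in_image[OF p, of j] by simp
    have "((\<lambda>t. signof p * (\<Prod>j<n. Y (p j) j t)) has_field_derivative
        signof p * (\<Sum>c<n. Y' (p c) c t * (\<Prod>j\<in>{..<n} - {c}. Y (p j) j t))) (at t)"
      by (intro DERIV_cmult has_field_derivative_prod) (auto intro!: assms pj)
    also have "(\<Sum>c<n. Y' (p c) c t * (\<Prod>j\<in>{..<n} - {c}. Y (p j) j t)) =
       (\<Sum>c<n. \<Prod>j<n. if j = c then Y' (p j) j t else Y (p j) j t)"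
      by (intro sum.cong refl, subst prod.remove[of "{..<n}"]) (auto intro!: prod.cong)
    finally show ?thesis by (simp add: sum_distrib_left)
  qed
  have "((\<lambda>t. \<Sum>p | p permutes {0..<n}. signof p * (\<Prod>j<n. Y (p j) j t)) has_field_derivative
      (\<Sum>p | p permutes {0..<n}. \<Sum>c<n. signof p *
          (\<Prod>j<n. if j = c then Y' (p j) j t else Y (p j) j t))) (at t)"
    by (rule DERIV_sum) (use summand in auto)
  then show ?thesis
    unfolding det_mat_leibniz by (subst (asm) sum.swap) simp
qed

section \<open>Vandermonde determinant of the roots of unity\<close>

text \<open>The polynomials vanishing at the first \<open>j\<close> nodes are the Newton basis of interpolation.\<close>

lemma newton_poly:
  fixes x :: "nat \<Rightarrow> 'a::idom"
  shows degree_newton_poly: "Polynomial.degree (\<Prod>l<j. [:- x l, 1:]) = j"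
    and lead_coeff_newton_poly: "Polynomial.coeff (\<Prod>l<j. [:- x l, 1:]) j = 1"
proof -
  show deg: "Polynomial.degree (\<Prod>l<j. [:- x l, 1:]) = j"
    by (subst degree_prod_eq_sum_degree) auto
  have "Polynomial.lead_coeff (\<Prod>l<j. [:- x l, 1:]) = 1"
    by (simp add: lead_coeff_prod)
  then show "Polynomial.coeff (\<Prod>l<j. [:- x l, 1:]) j = 1" by (simp only: deg)
qed

text \<open>Passing from powers to the Newton basis multiplies the Vandermonde matrix on the right by an
  upper triangular matrix with unit diagonal. The result is lower triangular, because the
  \<open>j\<close>-th basis polynomial vanishes at the earlier nodes, and its diagonal gives the product.\<close>

lemma det_vandermonde:
  fixes x :: "nat \<Rightarrow> 'a::idom"
  shows "Determinant.det (Matrix.mat n n (\<lambda>(k, j). x k ^ j)) = (\<Prod>j<n. \<Prod>l<j. x j - x l)"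
proof -
  define N where "N = (\<lambda>j. \<Prod>l<j. [:- x l, 1:])"
  define V where "V = Matrix.mat n n (\<lambda>(k, j). x k ^ j)"
  define U where "U = Matrix.mat n n (\<lambda>(i, j). Polynomial.coeff (N j) i)"
  define L where "L = Matrix.mat n n (\<lambda>(k, j). poly (N j) (x k))"
  have deg: "Polynomial.degree (N j) = j" for j unfolding N_def by (rule degree_newton_poly)
  have carrier: "V \<in> carrier_mat n n" "U \<in> carrier_mat n n" "L \<in> carrier_mat n n"
    by (auto simp: V_def U_def L_def)
  have "V * U = L"
  proof (rule eq_matI)
    fix k j assume "k < dim_row L" "j < dim_col L"
    then have kj: "k < n" "j < n" by (auto simp: L_def)
    have "(V * U) $$ (k, j) = (\<Sum>i<n. Polynomial.coeff (N j) i * x k ^ i)"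
      using kj by (simp add: V_def U_def scalar_prod_def lessThan_atLeast0 mult.commute)
    also have "\<dots> = (\<Sum>i\<le>j. Polynomial.coeff (N j) i * x k ^ i)"
      using kj deg by (intro sum.mono_neutral_right) (auto intro: coeff_eq_0)
    also have "\<dots> = L $$ (k, j)"
      using kj by (simp add: L_def poly_altdef deg)
    finally show "(V * U) $$ (k, j) = L $$ (k, j)" .
  qed (auto simp: V_def U_def L_def)
  then have "Determinant.det V * Determinant.det U = Determinant.det L"
    using det_mult[OF carrier(1,2)] by simp
  moreover have "Determinant.det U = 1"
  proof -
    have "upper_triangular U"
      by (auto simp: U_def upper_triangular_def deg intro!: coeff_eq_0)
    then show ?thesis
      using det_upper_triangular[OF _ carrier(2)] lead_coeff_newton_poly[of x]
      by (simp add: prod_list_diag_prod) (simp add: U_def N_def)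
  qed
  moreover have "Determinant.det L = (\<Prod>j<n. \<Prod>l<j. x j - x l)"
  proof -
    have "L $$ (i, j) = 0" if "i < j" "j < n" for i j
      using that by (auto simp: L_def N_def poly_prod)
    then have "Determinant.det L = prod_list (diag_mat L)"
      using carrier(3) by (rule det_lower_triangular)
    then show ?thesis
      by (simp add: prod_list_diag_prod L_def N_def poly_prod lessThan_atLeast0)
  qed
  ultimately show ?thesis by (simp add: V_def)
qed

lemma omega_Suc: "omega d (Suc k) = cis (2 * pi * real k / real d)"
  by (simp add: omega_def cis_conv_exp mult_ac)

lemma omega_power: "d \<ge> 1 \<Longrightarrow> omega d (Suc k) ^ d = 1"
  using cis_multiple_2pi[of "real k"] by (simp add: omega_Suc Complex.DeMoivre)

lemma norm_omega [simp]: "norm (omega d (Suc k)) = 1"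
  by (simp add: omega_Suc)

lemma inj_on_omega: "d \<ge> 1 \<Longrightarrow> inj_on (\<lambda>k. omega d (Suc k)) {..<d}"
  using Complex.bij_betw_roots_unity[of d] by (simp add: omega_Suc bij_betw_def)

text \<open>The product of the differences from one root to the others is the derivative of
  \<open>X\<^sup>d - 1 = \<Prod>\<^sub>j (X - \<omega>\<^sub>j)\<close> at that root.\<close>

lemma prod_omega_differences:
  assumes "i < d"
  shows "(\<Prod>j\<in>{..<d} - {i}. omega d (Suc i) - omega d (Suc j)) = of_nat d * omega d (Suc i) ^ (d - 1)"
proof -
  have d: "d \<ge> 1" using assms by simp
  let ?w = "\<lambda>k. omega d (Suc k)" and ?p = "\<Prod>j<d. [:- omega d (Suc j), 1:]"
  have "?p = Polynomial.monom 1 d - 1"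
  proof (rule poly_eqI_degree_lead_coeff[where A = "?w ` {..<d}" and n = d])
    show "Polynomial.coeff ?p d = Polynomial.coeff (Polynomial.monom 1 d - 1) d"
      using d by (simp add: lead_coeff_newton_poly)
    show "card (?w ` {..<d}) \<ge> d"
      using card_image[OF inj_on_omega[OF d]] by simp
    show "Polynomial.degree (Polynomial.monom 1 d - 1 :: complex poly) \<le> d"
      by (intro degree_diff_le) (auto simp: degree_monom_le)
    show "poly ?p z = poly (Polynomial.monom 1 d - 1) z" if "z \<in> ?w ` {..<d}" for z
      using that d by (auto simp: poly_prod poly_monom omega_power)
  qed (simp add: degree_newton_poly)
  then have "poly (pderiv ?p) (?w i) = of_nat d * ?w i ^ (d - 1)"
    by (simp add: pderiv_diff pderiv_monom poly_monom)
  moreover have "poly (pderiv ?p) (?w i) = (\<Sum>a<d. \<Prod>j\<in>{..<d} - {a}. ?w i - ?w j)"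
    by (simp add: pderiv_prod poly_sum poly_prod pderiv_pCons)
  moreover have "\<dots> = (\<Sum>a\<in>{i}. \<Prod>j\<in>{..<d} - {a}. ?w i - ?w j)"
    using assms by (intro sum.mono_neutral_right) auto
  ultimately show ?thesis by simp
qed

lemma prod_omega:
  assumes "d \<ge> 1"
  shows "(\<Prod>k<d. omega d (Suc k)) = (- 1) ^ (d - 1)"
proof -
  have cis: "(\<Prod>k<n. cis (c * real k)) = cis (c * (real n * (real n - 1) / 2))" for n c
    by (induction n) (auto simp: cis_mult field_simps)
  have "(\<Prod>k<d. omega d (Suc k)) = cis (2 * pi / real d * (real d * (real d - 1) / 2))"
    using cis[where c = "2 * pi / real d" and n = d] by (simp add: omega_Suc)
  also have "2 * pi / real d * (real d * (real d - 1) / 2) = real (d - 1) * pi"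
    using assms by (simp add: field_simps of_nat_diff)
  also have "cis (real (d - 1) * pi) = (- 1) ^ (d - 1)"
    by (simp flip: Complex.DeMoivre)
  finally show ?thesis .
qed

text \<open>A difference of two roots of unity splits into a phase and a real chord length. This
  separates the argument of the Vandermonde determinant from its modulus.\<close>

lemma omega_difference:
  "omega d (Suc l) - omega d (Suc k) =
     \<i> * cis (pi / real d * (real k + real l)) * of_real (2 * sin (pi * (real l - real k) / real d))"
proof -
  let ?s = "pi / real d * (real k + real l)" and ?t = "pi * (real l - real k) / real d"
  have "2 * pi * real l / real d = ?s + ?t" "2 * pi * real k / real d = ?s + (- ?t)"
    by (simp_all add: algebra_simps add_divide_distrib diff_divide_distrib)
  then have "omega d (Suc l) - omega d (Suc k) = cis ?s * (cis ?t - cis (- ?t))"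
    by (simp only: omega_Suc cis_mult[symmetric] right_diff_distrib)
  also have "cis ?t - cis (- ?t) = \<i> * of_real (2 * sin ?t)"
    by (simp add: complex_eq_iff)
  finally show ?thesis by (simp add: mult_ac)
qed

text \<open>The factors are the distances from \<open>1\<close> to the other roots of unity.\<close>

lemma prod_sin_multiples:
  assumes "d \<ge> 1"
  shows "(\<Prod>m=1..<d. 2 * sin (pi * real m / real d)) = real d"
proof -
  have "real d = norm (\<Prod>j\<in>{..<d} - {0}. omega d (Suc 0) - omega d (Suc j))"
    using prod_omega_differences[of 0 d] assms by (simp add: norm_mult norm_power)
  also have "\<dots> = (\<Prod>j\<in>{..<d} - {0}. norm (omega d (Suc j) - omega d (Suc 0)))"
    by (simp add: prod_norm[symmetric] norm_minus_commute)
  also have "\<dots> = (\<Prod>m=1..<d. 2 * sin (pi * real m / real d))"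
  proof (rule prod.cong)
    fix m assume "m \<in> {1..<d}"
    then have "sin (pi * real m / real d) \<ge> 0"
      by (intro sin_ge_zero) (auto simp: field_simps)
    then show "norm (omega d (Suc m) - omega d (Suc 0)) = 2 * sin (pi * real m / real d)"
      by (simp add: omega_difference norm_mult)
  qed auto
  finally show ?thesis by simp
qed

lemma vandermonde_roots_eq:
  "vandermonde_roots d = (\<Prod>l<d. \<Prod>k<l. omega d (Suc l) - omega d (Suc k))"
  unfolding vandermonde_roots_def by (rule det_vandermonde)

lemma vandermonde_roots_eq_pairs:
  "vandermonde_roots d = (\<Prod>(i, j)\<in>{(i, j). 1 \<le> i \<and> i < j \<and> j \<le> d}. omega d j - omega d i)"
proof -
  have "vandermonde_roots d = (\<Prod>(l, k)\<in>(SIGMA l:{..<d}. {..<l}). omega d (Suc l) - omega d (Suc k))"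
    by (simp add: vandermonde_roots_eq prod.Sigma)
  also have "\<dots> = (\<Prod>(i, j)\<in>{(i, j). 1 \<le> i \<and> i < j \<and> j \<le> d}. omega d j - omega d i)"
    by (rule prod.reindex_bij_witness[of _ "\<lambda>(i, j). (j - 1, i - 1)" "\<lambda>(l, k). (Suc k, Suc l)"]) auto
  finally show ?thesis .
qed

lemma prod_omega_pairs:
  assumes "d \<ge> 1"
  shows "(\<Prod>(i, j)\<in>{(i, j). i \<in> {1..d} \<and> j \<in> {1..d} \<and> i \<noteq> j}. omega d i - omega d j)
           = (- 1) ^ (d - 1) * of_nat d ^ d"
proof -
  have "(\<Prod>(i, j)\<in>{(i, j). i \<in> {1..d} \<and> j \<in> {1..d} \<and> i \<noteq> j}. omega d i - omega d j)
      = (\<Prod>(i, j)\<in>(SIGMA i:{..<d}. {..<d} - {i}). omega d (Suc i) - omega d (Suc j))"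
    by (rule prod.reindex_bij_witness[of _ "\<lambda>(i, j). (Suc i, Suc j)" "\<lambda>(i, j). (i - 1, j - 1)"]) auto
  also have "\<dots> = (\<Prod>i<d. \<Prod>j\<in>{..<d} - {i}. omega d (Suc i) - omega d (Suc j))"
    by (simp add: prod.Sigma)
  also have "\<dots> = (\<Prod>i<d. of_nat d * omega d (Suc i) ^ (d - 1))"
    by (intro prod.cong refl prod_omega_differences) auto
  also have "\<dots> = of_nat d ^ d * ((- 1) ^ (d - 1)) ^ (d - 1)"
    using prod_omega[OF assms] by (simp add: prod.distrib flip: prod_power_distrib)
  also have "((- 1) ^ (d - 1)) ^ (d - 1) = ((- 1) ^ (d - 1) :: complex)"
    by (cases "even (d - 1)") auto
  finally show ?thesis by (simp add: mult.commute)
qed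

text \<open>The ordered pairs of distinct roots contain every unordered pair twice, so their product has
  modulus \<open>\<bar>V\<^sub>d\<bar>\<^sup>2\<close>.\<close>

lemma norm_vandermonde_roots:
  assumes "d \<ge> 1"
  shows "norm (vandermonde_roots d) = real d powr (real d / 2)"
proof -
  let ?A = "SIGMA l:{..<d}. {..<l}" and ?g = "\<lambda>(l, k). norm (omega d (Suc l) - omega d (Suc k))"
  have V: "norm (vandermonde_roots d) = prod ?g ?A"
    by (simp add: vandermonde_roots_eq prod.Sigma prod_norm[symmetric] case_prod_unfold)
  have "real d ^ d = norm (\<Prod>i<d. \<Prod>j\<in>{..<d} - {i}. omega d (Suc i) - omega d (Suc j))"
    using prod_omega_differences[of _ d] by (simp add: norm_mult norm_power prod_norm[symmetric])
  also have "\<dots> = prod ?g (SIGMA i:{..<d}. {..<d} - {i})"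
    by (simp add: prod.Sigma prod_norm[symmetric] case_prod_unfold)
  also have "(SIGMA i:{..<d}. {..<d} - {i}) = ?A \<union> prod.swap ` ?A"
    by (auto simp: image_iff)
  also have "prod ?g (?A \<union> prod.swap ` ?A) = prod ?g ?A * prod ?g (prod.swap ` ?A)"
    by (rule prod.union_disjoint) auto
  also have "prod ?g (prod.swap ` ?A) = prod ?g ?A"
    by (subst prod.reindex) (auto simp: norm_minus_commute intro!: prod.cong inj_onI)
  finally have "norm (vandermonde_roots d) ^ 2 = real d ^ d"
    by (simp add: V power2_eq_square)
  also have "\<dots> = (real d powr (real d / 2)) ^ 2"
    using assms powr_realpow[of "real d" d] by (simp add: power2_eq_square flip: powr_add)
  finally show ?thesis by simp
qed

text \<open>The phases of the differences multiply to \<open>\<i>\<close> to the power \<open>d (d - 1) / 2 + (d - 1)\<^sup>2\<close>; the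
  remaining real factor is nonnegative and is therefore the modulus.\<close>

lemma vandermonde_roots_value:
  assumes "d \<ge> 1"
  shows "vandermonde_roots d = \<i> ^ ((d - 1) * (3 * d - 2) div 2) * of_real (real d powr (real d / 2))"
proof -
  define s where "s = (\<Prod>l<d. \<Prod>k<l. 2 * sin (pi * (real l - real k) / real d))"
  define u where "u = (\<Prod>l<d. \<Prod>k<l. \<i> * cis (pi / real d * (real k + real l)))"
  have V: "vandermonde_roots d = u * of_real s"
    unfolding u_def s_def
    by (simp only: vandermonde_roots_eq omega_difference of_real_prod prod.distrib[symmetric])
  have inner: "(\<Prod>k<n. \<i> * cis (c * (real k + r))) = \<i> ^ n * cis (c * (real n * (real n - 1) / 2 + real n * r))"
    for n c r
    by (induction n) (auto simp: cis_mult field_simps)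
  have outer: "(\<Prod>l<n. \<Prod>k<l. \<i> * cis (c * (real k + real l)))
      = \<i> ^ (n * (n - 1) div 2) * cis (c * (real n * (real n - 1) ^ 2 / 2))" for n c
  proof (induction n)
    case (Suc n)
    have pairs: "Suc n * (Suc n - 1) div 2 = n * (n - 1) div 2 + n"
      by (cases n) (auto simp: algebra_simps)
    have "(\<Prod>l<Suc n. \<Prod>k<l. \<i> * cis (c * (real k + real l)))
        = \<i> ^ (n * (n - 1) div 2) * cis (c * (real n * (real n - 1) ^ 2 / 2)) *
          (\<i> ^ n * cis (c * (real n * (real n - 1) / 2 + real n * real n)))"
      by (subst prod.lessThan_Suc, subst Suc.IH, subst inner) (rule refl)
    also have "\<dots> = \<i> ^ (Suc n * (Suc n - 1) div 2) *
        cis (c * (real n * (real n - 1) ^ 2 / 2) + c * (real n * (real n - 1) / 2 + real n * real n))"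
      by (simp only: pairs power_add cis_mult[symmetric] mult_ac)
    also have "c * (real n * (real n - 1) ^ 2 / 2) + c * (real n * (real n - 1) / 2 + real n * real n)
        = c * (real (Suc n) * (real (Suc n) - 1) ^ 2 / 2)"
      by (simp add: power2_eq_square algebra_simps add_divide_distrib diff_divide_distrib)
    finally show ?case .
  qed simp
  have "u = \<i> ^ (d * (d - 1) div 2) * cis (pi / real d * (real d * (real d - 1) ^ 2 / 2))"
    unfolding u_def by (rule outer)
  also have "pi / real d * (real d * (real d - 1) ^ 2 / 2) = real ((d - 1) ^ 2) * (pi / 2)"
    using assms by (simp add: field_simps of_nat_diff)
  also have "cis \<dots> = \<i> ^ ((d - 1) ^ 2)"
    by (simp only: Complex.DeMoivre[symmetric] cis_pi_half)
  also have "\<i> ^ (d * (d - 1) div 2) * \<i> ^ ((d - 1) ^ 2) = \<i> ^ ((d - 1) * (3 * d - 2) div 2)"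
  proof -
    obtain n where n: "d = Suc n" using assms by (cases d) auto
    have "d * (d - 1) div 2 + (d - 1) ^ 2 = (d - 1) * (3 * d - 2) div 2"
      by (simp add: n power2_eq_square algebra_simps)
    then show ?thesis by (simp flip: power_add)
  qed
  finally have u: "u = \<i> ^ ((d - 1) * (3 * d - 2) div 2)" .
  have "sin (pi * (real l - real k) / real d) \<ge> 0" if "k < l" "l < d" for k l
  proof (rule sin_ge_zero)
    show "pi * (real l - real k) / real d \<le> pi"
      using that mult_left_mono[of "real l - real k" "real d" pi] by (simp add: pos_divide_le_eq)
  qed (use that in auto)
  then have "s \<ge> 0" unfolding s_def
    by (intro prod_nonneg ballI mult_nonneg_nonneg) auto
  moreover have "norm (vandermonde_roots d) = \<bar>s\<bar>"
    by (simp add: V u norm_mult norm_power)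
  ultimately have "s = real d powr (real d / 2)"
    using norm_vandermonde_roots[OF assms] by simp
  then show ?thesis by (simp add: V u)
qed

section \<open>Moments along the rays\<close>

lemma poly_P0: "poly (P0 d b) z = - (z ^ d) / of_nat d + (\<Sum>i<d. b i * z ^ i)"
  by (simp add: P0_def poly_monom poly_sum)

text \<open>The integrand is entire, so \<open>F P j\<close> is its primitive vanishing at the origin. The tail
  estimates and the recurrence of the moments then need only derivatives of \<open>F P j\<close>.\<close>

lemma DERIV_F: "(F P j has_field_derivative z ^ j * exp (poly P z)) (at z)"
  and F_0 [simp]: "F P j 0 = 0"
proof -
  have "(\<lambda>t. t ^ j * exp (poly P t)) holomorphic_on UNIV"
    by (intro holomorphic_intros)
  then obtain G where G: "\<And>t. (G has_field_derivative t ^ j * exp (poly P t)) (at t)"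
    using holomorphic_convex_primitive'[of UNIV "\<lambda>t. t ^ j * exp (poly P t)"] by auto
  have "F P j = (\<lambda>z. G z - G 0)"
  proof
    fix z
    have "((\<lambda>t. t ^ j * exp (poly P t)) has_contour_integral
        (G (pathfinish (linepath 0 z)) - G (pathstart (linepath 0 z)))) (linepath 0 z)"
      by (rule contour_integral_primitive[OF _ valid_path_linepath, where S = UNIV]) (use G in auto)
    then show "F P j z = G z - G 0"
      unfolding F_def by (simp add: contour_integral_unique)
  qed
  then show "(F P j has_field_derivative z ^ j * exp (poly P z)) (at z)" "F P j 0 = 0"
    using G by (auto intro!: derivative_eq_intros)
qed

lemma F_along_ray:
  "((\<lambda>r. F P j (of_real r * w)) has_vector_derivative w * ((of_real r * w) ^ j * exp (poly P (of_real r * w))))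
     (at r within S)"
proof -
  have "((\<lambda>r. of_real r * w) has_vector_derivative of_real 1 * w) (at r within S)"
    by (intro has_vector_derivative_mult_left has_vector_derivative_of_real DERIV_ident)
  from field_vector_diff_chain_within[OF this DERIV_F[THEN has_field_derivative_at_within]]
  show ?thesis by (simp add: o_def)
qed

lemma F_eq_integral:
  "F P j z = integral (cbox 0 1) (\<lambda>x. (of_real x * z) ^ j * exp (poly P (of_real x * z)) * z)"
  unfolding F_def contour_integral_integral
  by (simp add: linepath_def scaleR_conv_of_real vector_derivative_linepath_within mult_ac)

text \<open>Varying the coefficients along the line through \<open>a\<close> multiplies the integrand by
  \<open>\<Sum>\<^sub>m a\<^sub>m z\<^sup>m\<close>, hence only raises the indices of the moments.\<close>

lemma DERIV_F_parameter:
  "((\<lambda>t. F (P0 d (\<lambda>i. t * a i)) j z) has_field_derivative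
      (\<Sum>m<d. a m * F (P0 d (\<lambda>i. t * a i)) (j + m) z)) (at t)"
proof -
  let ?P = "\<lambda>t. P0 d (\<lambda>i. t * a i)"
  let ?f = "\<lambda>j t x. (of_real x * z) ^ j * exp (poly (?P t) (of_real x * z)) * z"
  have integrable: "?f j t integrable_on cbox 0 1" for j t
    by (intro integrable_continuous continuous_intros)
  have "((\<lambda>t. integral (cbox 0 1) (?f j t)) has_field_derivative
      integral (cbox 0 1) (\<lambda>x. \<Sum>m<d. a m * ?f (j + m) t x)) (at t within UNIV)"
  proof (rule leibniz_rule_field_derivative)
    fix t :: complex and x :: real
    have "((\<lambda>t. poly (?P t) (of_real x * z)) has_field_derivative (\<Sum>i<d. a i * (of_real x * z) ^ i)) (at t)"
      unfolding poly_P0 by (auto intro!: derivative_eq_intros)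
    then have "((\<lambda>t. ?f j t x) has_field_derivative (of_real x * z) ^ j * (exp (poly (?P t) (of_real x * z)) *
        (\<Sum>i<d. a i * (of_real x * z) ^ i)) * z) (at t)"
      by (intro DERIV_cmult DERIV_cmult_right DERIV_fun_exp)
    also have "(of_real x * z) ^ j * (exp (poly (?P t) (of_real x * z)) * (\<Sum>i<d. a i * (of_real x * z) ^ i)) * z
        = (\<Sum>m<d. a m * ?f (j + m) t x)"
      unfolding sum_distrib_left sum_distrib_right power_add by (intro sum.cong refl) (simp only: mult_ac)
    finally show "((\<lambda>t. ?f j t x) has_field_derivative (\<Sum>m<d. a m * ?f (j + m) t x)) (at t within UNIV)"
      by simp
  next
    show "continuous_on (UNIV \<times> cbox 0 1) (\<lambda>(t, x). \<Sum>m<d. a m * ?f (j + m) t x)"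
      unfolding case_prod_unfold poly_P0 by (intro continuous_intros) auto
  qed (use integrable in auto)
  also have "integral (cbox 0 1) (\<lambda>x. \<Sum>m<d. a m * ?f (j + m) t x) = (\<Sum>m<d. a m * integral (cbox 0 1) (?f (j + m) t))"
    using integrable by (subst integral_sum) (auto intro!: integrable_on_mult_right)
  finally show ?thesis by (simp only: F_eq_integral)
qed

lemma power_le_exp:
  fixes x c :: real
  assumes "x \<ge> 0" "c > 0"
  shows "x ^ j \<le> fact j / c ^ j * exp (c * x)"
proof -
  have "(c * x) ^ j / fact j \<le> exp (c * x)"
  proof -
    have "sum (\<lambda>n. inverse (fact n) *\<^sub>R (c * x) ^ n) {j} \<le> suminf (\<lambda>n. inverse (fact n) *\<^sub>R (c * x) ^ n)"
      by (rule sum_le_suminf) (use assms summable_exp_generic[of "c * x"] in auto)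
    then show ?thesis by (simp add: exp_def field_simps)
  qed
  then show ?thesis using assms by (simp add: field_simps power_mult_distrib)
qed

context
  fixes d :: nat and w :: complex
  assumes d: "d \<ge> 1" and w: "w ^ d = 1"
begin

lemma norm_direction: "norm w = 1"
proof -
  have "norm w ^ d = 1" using w by (simp flip: norm_power)
  then show ?thesis using d power_eq_imp_eq_base[of "norm w" d 1] by simp
qed

text \<open>On a ray in the direction of a \<open>d\<close>-th root of unity the leading term of the exponent is
  \<open>- x\<^sup>d / d\<close>, and for large \<open>x\<close> it dominates the lower terms. The bound and the point from
  which it holds depend on the coefficients only through \<open>A\<close>; this uniformity is what later
  allows differentiation of the improper integrals with respect to the coefficients. Half of
  the decay absorbs the power of \<open>x\<close>.\<close>

lemma integrand_bound:
  assumes b: "\<And>i. i < d \<Longrightarrow> norm (b i) \<le> A"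
    and x: "x \<ge> 1" "x \<ge> 2 * real d ^ 2 * A"
  shows "norm ((of_real x * w) ^ j * exp (poly (P0 d b) (of_real x * w)))
           \<le> fact j * (4 * real d) ^ j * exp (- (x / (4 * real d)))"
proof -
  have pow: "norm ((of_real x * w) ^ j) = x ^ j"
    using x by (simp add: norm_mult norm_power norm_direction)
  have leading: "- ((of_real x * w) ^ d) / of_nat d = (of_real (- (x ^ d) / real d) :: complex)"
    by (simp add: power_mult_distrib w)
  have A: "A \<ge> 0" using b[of 0] d norm_ge_zero[of "b 0"] by linarith
  have "Re (\<Sum>i<d. b i * (of_real x * w) ^ i) \<le> (\<Sum>i<d. norm (b i * (of_real x * w) ^ i))"
    by (rule order_trans[OF complex_Re_le_cmod norm_sum])
  also have "\<dots> \<le> (\<Sum>i<d. A * x ^ (d - 1))"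
    using b x A by (intro sum_mono) (auto simp: norm_mult norm_power norm_direction intro!: mult_mono power_increasing)
  finally have "Re (poly (P0 d b) (of_real x * w)) \<le> - (x ^ d) / real d + real d * A * x ^ (d - 1)"
    unfolding poly_P0 leading by simp
  also have "\<dots> = x ^ (d - 1) * (real d * A - x / real d)"
    using d by (cases d) (auto simp: field_simps)
  also have "\<dots> \<le> x ^ (d - 1) * (- (x / (2 * real d)))"
    using x d by (intro mult_left_mono) (auto simp: field_simps power2_eq_square)
  also have "\<dots> \<le> 1 * (- (x / (2 * real d)))"
    using x one_le_power[of x "d - 1"] d by (intro mult_right_mono_neg) auto
  finally have Re: "Re (poly (P0 d b) (of_real x * w)) \<le> - (x / (2 * real d))" by simp
  have "norm ((of_real x * w) ^ j * exp (poly (P0 d b) (of_real x * w))) \<le> x ^ j * exp (- (x / (2 * real d)))"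
    unfolding norm_mult[of "_ ^ j"] pow norm_exp_eq_Re
    using Re x by (intro mult_left_mono) auto
  also have "\<dots> \<le> (fact j / (1 / (4 * real d)) ^ j * exp (1 / (4 * real d) * x)) * exp (- (x / (2 * real d)))"
    using x d by (intro mult_right_mono power_le_exp) auto
  also have "\<dots> = fact j * (4 * real d) ^ j * exp (- (x / (4 * real d)))"
    using d by (simp add: field_simps flip: exp_add)
  finally show ?thesis .
qed

definition tail_start :: "real \<Rightarrow> real" where
  "tail_start A = max 1 (2 * real d ^ 2 * A)"

definition tail_const :: "nat \<Rightarrow> real" where
  "tail_const j = fact j * (4 * real d) ^ j * (4 * real d)"

lemma tail_bound:
  assumes b: "\<And>i. i < d \<Longrightarrow> norm (b i) \<le> A"
    and rs: "tail_start A \<le> r" "r \<le> s"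
  shows "norm (F (P0 d b) j (of_real s * w) - F (P0 d b) j (of_real r * w))
           \<le> tail_const j * exp (- (r / (4 * real d)))"
proof (cases "r = s")
  case True
  then show ?thesis by (simp add: tail_const_def)
next
  case False
  let ?f = "\<lambda>x. F (P0 d b) j (of_real x * w)"
  let ?phi = "\<lambda>x. - tail_const j * exp (- (x / (4 * real d)))"
  have "norm (?f s - ?f r) \<le> ?phi s - ?phi r"
  proof (rule differentiable_bound_general)
    show "continuous_on {r..s} ?f"
      using F_along_ray by (intro continuous_on_vector_derivative)
    show "continuous_on {r..s} ?phi" by (intro continuous_intros) (use d in auto)
    show "(?f has_vector_derivative w * ((of_real x * w) ^ j * exp (poly (P0 d b) (of_real x * w)))) (at x)" for x
      by (rule F_along_ray)
    show "(?phi has_vector_derivative fact j * (4 * real d) ^ j * exp (- (x / (4 * real d)))) (at x)" for x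
      using d unfolding tail_const_def has_real_derivative_iff_has_vector_derivative[symmetric]
      by (auto intro!: derivative_eq_intros simp: field_simps)
    show "norm (w * ((of_real x * w) ^ j * exp (poly (P0 d b) (of_real x * w))))
        \<le> fact j * (4 * real d) ^ j * exp (- (x / (4 * real d)))" if "r < x" for x
      using integrand_bound[where b = b and A = A and x = x and j = j] that rs
      by (simp add: tail_start_def norm_mult norm_direction b)
  qed (use rs False in auto)
  also have "\<dots> \<le> - ?phi r" by (simp add: tail_const_def)
  finally show ?thesis by simp
qed

lemma tail_const_exp_tendsto_0: "((\<lambda>r. tail_const j * exp (- (r / (4 * real d)))) \<longlongrightarrow> 0) at_top"
proof -
  have "filterlim (\<lambda>r. r / (4 * real d)) at_top at_top"
    using d filterlim_tendsto_pos_mult_at_top[OF tendsto_const[of "1 / (4 * real d)"] _ filterlim_ident[of at_top]]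
    by simp
  then have "((\<lambda>r. exp (- (r / (4 * real d)))) \<longlongrightarrow> 0) at_top"
    by (intro filterlim_compose[OF exp_at_bot] filterlim_compose[OF filterlim_uminus_at_bot_at_top])
  then show ?thesis by (rule tendsto_mult_right_zero)
qed

text \<open>By the tail bound the partial integrals satisfy the Cauchy criterion; the bound survives the
  passage to the limit and keeps its uniformity over coefficients bounded by \<open>A\<close>.\<close>

lemma ram_value_tail:
  assumes b: "\<And>i. i < d \<Longrightarrow> norm (b i) \<le> A"
  shows ram_value_tendsto_bounded: "((\<lambda>r. F (P0 d b) j (of_real r * w)) \<longlongrightarrow> ram_value (P0 d b) j w) at_top"
    and ram_value_bound: "tail_start A \<le> r \<Longrightarrow>
        norm (F (P0 d b) j (of_real r * w) - ram_value (P0 d b) j w) \<le> tail_const j * exp (- (r / (4 * real d)))"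
proof -
  let ?f = "\<lambda>r. F (P0 d b) j (of_real r * w)"
  let ?e = "\<lambda>r. tail_const j * exp (- (r / (4 * real d)))"
  have diff: "norm (?f r - ?f s) \<le> ?e r" if "tail_start A \<le> r" "r \<le> s" for r s
    using tail_bound[OF b that] by (simp add: norm_minus_commute)
  have seq: "(\<lambda>n. ?e (real n)) \<longlonglongrightarrow> 0"
    by (rule filterlim_compose[OF tail_const_exp_tendsto_0 filterlim_real_sequentially])
  have "Cauchy (\<lambda>n. ?f (real n))"
  proof (rule CauchyI')
    fix e :: real assume "e > 0"
    with seq have "\<forall>\<^sub>F n in sequentially. ?e (real n) < e" by (rule order_tendstoD)
    moreover have "\<forall>\<^sub>F n in sequentially. tail_start A \<le> real n"
      using filterlim_real_sequentially by (auto simp: filterlim_at_top)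
    ultimately have "\<forall>\<^sub>F n in sequentially. ?e (real n) < e \<and> tail_start A \<le> real n"
      by (rule eventually_conj)
    then obtain N where N: "\<And>n. n \<ge> N \<Longrightarrow> ?e (real n) < e \<and> tail_start A \<le> real n"
      by (auto simp: eventually_sequentially)
    then show "\<exists>M. \<forall>m\<ge>M. \<forall>n>m. dist (?f (real m)) (?f (real n)) < e"
      unfolding dist_norm
    proof (intro exI[of _ N] allI impI)
      fix m n assume "N \<le> m" "m < n"
      then show "norm (?f (real m) - ?f (real n)) < e"
        using diff[of "real m" "real n"] N[of m] by auto
    qed
  qed
  then obtain L where L: "(\<lambda>n. ?f (real n)) \<longlonglongrightarrow> L"
    by (auto simp: Cauchy_convergent_iff convergent_def)
  have bound: "norm (?f r - L) \<le> ?e r" if "tail_start A \<le> r" for r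
  proof (rule tendsto_upperbound)
    show "(\<lambda>n. norm (?f r - ?f (real n))) \<longlonglongrightarrow> norm (?f r - L)"
      by (intro tendsto_intros L)
    have "\<forall>\<^sub>F n in sequentially. r \<le> real n"
      using filterlim_real_sequentially by (auto simp: filterlim_at_top)
    then show "\<forall>\<^sub>F n in sequentially. norm (?f r - ?f (real n)) \<le> ?e r"
      by eventually_elim (use diff[OF that] in blast)
  qed auto
  have "((\<lambda>r. ?f r - L) \<longlongrightarrow> 0) at_top"
  proof (rule Lim_null_comparison[OF _ tail_const_exp_tendsto_0])
    show "\<forall>\<^sub>F r in at_top. norm (?f r - L) \<le> ?e r"
      using eventually_ge_at_top[of "tail_start A"] by eventually_elim (rule bound)
  qed
  then have lim: "(?f \<longlongrightarrow> L) at_top" by (simp add: LIM_zero_iff)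
  then have "ram_value (P0 d b) j w = L"
    unfolding ram_value_def by (intro tendsto_Lim) auto
  with lim bound show "(?f \<longlongrightarrow> ram_value (P0 d b) j w) at_top"
    "tail_start A \<le> r \<Longrightarrow> norm (?f r - ram_value (P0 d b) j w) \<le> ?e r" by auto
qed

lemma ram_value_tendsto: "((\<lambda>r. F (P0 d b) j (of_real r * w)) \<longlongrightarrow> ram_value (P0 d b) j w) at_top"
proof (rule ram_value_tendsto_bounded)
  show "norm (b i) \<le> (\<Sum>i<d. norm (b i))" if "i < d" for i
    using that by (intro member_le_sum) auto
qed

text \<open>Integration by parts: the right-hand side is the primitive, vanishing at \<open>0\<close>, of
  \<open>((n + 1) z\<^sup>n + z\<^bsup>n+1\<^esup> P'(z)) e\<^bsup>P(z)\<^esup>\<close>. The power \<open>n + 1 \<ge> 1\<close> is what removes the boundary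
  term at the origin.\<close>

lemma F_recurrence:
  "of_nat (Suc n) * F (P0 d b) n z + (\<Sum>l=1..<d. of_nat l * b l * F (P0 d b) (n + l) z) - F (P0 d b) (n + d) z
     = z ^ Suc n * exp (poly (P0 d b) z)"
proof -
  let ?E = "\<lambda>z. exp (poly (P0 d b) z)"
  let ?H = "\<lambda>z. of_nat (Suc n) * F (P0 d b) n z + (\<Sum>l=1..<d. of_nat l * b l * F (P0 d b) (n + l) z)
      - F (P0 d b) (n + d) z - z ^ Suc n * ?E z"
  have "(?H has_field_derivative 0) (at z)" for z
  proof -
    have P': "(poly (P0 d b) has_field_derivative
        (\<Sum>l=1..<d. of_nat l * b l * z ^ (l - 1)) - z ^ (d - 1)) (at z)"
    proof -
      have "((\<lambda>z. - (z ^ d) / of_nat d + (\<Sum>i<d. b i * z ^ i)) has_field_derivative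
         - (of_nat d * z ^ (d - 1)) / of_nat d + (\<Sum>i<d. b i * (of_nat i * z ^ (i - 1)))) (at z)"
        using d by (intro derivative_intros DERIV_cdivide DERIV_minus DERIV_cmult) (auto intro!: derivative_eq_intros)
      moreover have "(\<Sum>i<d. b i * (of_nat i * z ^ (i - 1))) = (\<Sum>l=1..<d. of_nat l * b l * z ^ (l - 1))"
        using d by (intro sum.mono_neutral_cong_right) (auto simp: mult_ac)
      ultimately show ?thesis using d by (simp add: poly_P0[abs_def])
    qed
    have "(?H has_field_derivative of_nat (Suc n) * (z ^ n * ?E z)
        + (\<Sum>l=1..<d. of_nat l * b l * (z ^ (n + l) * ?E z)) - z ^ (n + d) * ?E z
        - (z ^ Suc n * (?E z * ((\<Sum>l=1..<d. of_nat l * b l * z ^ (l - 1)) - z ^ (d - 1)))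
           + of_nat (Suc n) * z ^ n * ?E z)) (at z)"
      by (rule derivative_eq_intros DERIV_F P' refl)+ (simp_all add: mult_ac)
    moreover have "(\<Sum>l=1..<d. of_nat l * b l * (z ^ (n + l) * ?E z))
        = z ^ Suc n * (?E z * (\<Sum>l=1..<d. of_nat l * b l * z ^ (l - 1)))"
      unfolding sum_distrib_left
    proof (rule sum.cong[OF refl])
      fix l assume "l \<in> {1..<d}"
      then have "n + l = Suc n + (l - 1)" by auto
      then have "z ^ (n + l) = z ^ Suc n * z ^ (l - 1)" by (simp only: power_add)
      then show "of_nat l * b l * (z ^ (n + l) * ?E z) = z ^ Suc n * (?E z * (of_nat l * b l * z ^ (l - 1)))"
        by (simp add: mult_ac)
    qed
    moreover have "z ^ (n + d) = z ^ Suc n * z ^ (d - 1)"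
    proof -
      have "n + d = Suc n + (d - 1)" using d by auto
      then show ?thesis by (simp only: power_add)
    qed
    ultimately show ?thesis by (simp add: algebra_simps)
  qed
  then obtain c where c: "\<And>z. ?H z = c"
    using has_field_derivative_zero_constant[of UNIV ?H] by auto
  from c[of 0] have "c = 0" by simp
  with c[of z] show ?thesis by simp
qed

lemma ram_value_recurrence:
  "ram_value (P0 d b) (n + d) w = of_nat (Suc n) * ram_value (P0 d b) n w
     + (\<Sum>l=1..<d. of_nat l * b l * ram_value (P0 d b) (n + l) w)"
proof -
  let ?E = "\<lambda>r. (of_real r * w) ^ Suc n * exp (poly (P0 d b) (of_real r * w))"
  have b: "norm (b i) \<le> (\<Sum>i<d. norm (b i))" if "i < d" for i
    using that by (intro member_le_sum) auto
  have "\<forall>\<^sub>F r in at_top. norm (?E r) \<le> tail_const (Suc n) * exp (- (r / (4 * real d)))"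
    using eventually_ge_at_top[of "tail_start (\<Sum>i<d. norm (b i))"]
  proof eventually_elim
    case (elim r)
    then have "norm (?E r) \<le> fact (Suc n) * (4 * real d) ^ Suc n * exp (- (r / (4 * real d))) * 1"
      using integrand_bound[where b = b and x = r and j = "Suc n", OF b] by (simp add: tail_start_def)
    also have "\<dots> \<le> fact (Suc n) * (4 * real d) ^ Suc n * exp (- (r / (4 * real d))) * (4 * real d)"
      using d by (intro mult_left_mono) auto
    finally show ?case by (simp add: tail_const_def mult_ac)
  qed
  then have E: "(?E \<longlongrightarrow> 0) at_top"
    by (rule Lim_null_comparison[OF _ tail_const_exp_tendsto_0])
  have "(?E \<longlongrightarrow> of_nat (Suc n) * ram_value (P0 d b) n w
     + (\<Sum>l=1..<d. of_nat l * b l * ram_value (P0 d b) (n + l) w) - ram_value (P0 d b) (n + d) w) at_top"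
    unfolding F_recurrence[symmetric] by (intro tendsto_intros ram_value_tendsto)
  with E have "0 = of_nat (Suc n) * ram_value (P0 d b) n w
     + (\<Sum>l=1..<d. of_nat l * b l * ram_value (P0 d b) (n + l) w) - ram_value (P0 d b) (n + d) w"
    by (intro tendsto_unique[of at_top ?E]) auto
  then show ?thesis by simp
qed

text \<open>The partial integrals are entire in \<open>t\<close> and converge locally uniformly, so by Weierstrass the
  limit may be differentiated term by term.\<close>

lemma DERIV_ram_value_parameter:
  "((\<lambda>t. ram_value (P0 d (\<lambda>i. t * a i)) j w) has_field_derivative
      (\<Sum>m<d. a m * ram_value (P0 d (\<lambda>i. t * a i)) (j + m) w)) (at t)"
proof -
  let ?P = "\<lambda>t. P0 d (\<lambda>i. t * a i)"
  let ?f = "\<lambda>n t. F (?P t) j (of_real (real n) * w)"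
  let ?f' = "\<lambda>n t. \<Sum>m<d. a m * F (?P t) (j + m) (of_real (real n) * w)"
  have "\<exists>g'. \<forall>t\<in>UNIV. ((\<lambda>t. ram_value (?P t) j w) has_field_derivative g' t) (at t) \<and> (\<lambda>n. ?f' n t) \<longlonglongrightarrow> g' t"
  proof (rule has_complex_derivative_uniform_sequence)
    show "(?f n has_field_derivative ?f' n t) (at t)" for n t
      by (rule DERIV_F_parameter)
    fix s :: complex
    define A where "A = (norm s + 1) * (\<Sum>i<d. norm (a i))"
    have A: "norm (t * a i) \<le> A" if "t \<in> cball s 1" "i < d" for t i
    proof -
      have "norm t \<le> norm s + 1"
        using that(1) norm_triangle_ineq2[of t s] by (simp add: dist_norm norm_minus_commute)
      moreover have "norm (a i) \<le> (\<Sum>i<d. norm (a i))"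
        using that(2) by (intro member_le_sum) auto
      ultimately show ?thesis
        unfolding A_def norm_mult by (intro mult_mono) auto
    qed
    have "uniform_limit (cball s 1) ?f (\<lambda>t. ram_value (?P t) j w) sequentially"
    proof (rule uniform_limitI)
      fix e :: real assume "e > 0"
      have "(\<lambda>n. tail_const j * exp (- (real n / (4 * real d)))) \<longlonglongrightarrow> 0"
        by (rule filterlim_compose[OF tail_const_exp_tendsto_0 filterlim_real_sequentially])
      then have "\<forall>\<^sub>F n in sequentially. tail_const j * exp (- (real n / (4 * real d))) < e"
        using \<open>e > 0\<close> by (rule order_tendstoD)
      moreover have "\<forall>\<^sub>F n in sequentially. tail_start A \<le> real n"
        using filterlim_real_sequentially by (auto simp: filterlim_at_top)
      ultimately show "\<forall>\<^sub>F n in sequentially. \<forall>t\<in>cball s 1. dist (?f n t) (ram_value (?P t) j w) < e"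
      proof eventually_elim
        case (elim n)
        show ?case
        proof
          fix t assume "t \<in> cball s 1"
          then have "norm (?f n t - ram_value (?P t) j w) \<le> tail_const j * exp (- (real n / (4 * real d)))"
            by (intro ram_value_bound[OF A] elim(2))
          with elim(1) show "dist (?f n t) (ram_value (?P t) j w) < e"
            unfolding dist_norm by simp
        qed
      qed
    qed
    then show "\<exists>r>0. cball s r \<subseteq> UNIV \<and> uniform_limit (cball s r) ?f (\<lambda>t. ram_value (?P t) j w) sequentially"
      by (intro exI[of _ 1]) auto
  qed auto
  then obtain g' where g': "((\<lambda>t. ram_value (?P t) j w) has_field_derivative g' t) (at t)"
      "(\<lambda>n. ?f' n t) \<longlonglongrightarrow> g' t" by auto
  have "(\<lambda>n. ?f' n t) \<longlonglongrightarrow> (\<Sum>m<d. a m * ram_value (?P t) (j + m) w)"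
    by (intro tendsto_intros filterlim_compose[OF ram_value_tendsto filterlim_real_sequentially])
  then have "g' t = (\<Sum>m<d. a m * ram_value (?P t) (j + m) w)"
    by (rule LIMSEQ_unique[OF g'(2)])
  with g'(1) show ?thesis by simp
qed

end

section \<open>Moments for the pure power\<close>

text \<open>The square of the product pairs \<open>m\<close> with \<open>d - m\<close>; Euler's reflection formula turns it into the
  product of sines at the multiples of \<open>\<pi> / d\<close>.\<close>

lemma prod_Gamma_multiples:
  assumes "d \<ge> 1"
  shows "(\<Prod>j<d. Gamma (real (Suc j) / real d)) = sqrt ((2 * pi) ^ (d - 1) / real d)"
proof -
  let ?G = "\<Prod>m=1..<d. Gamma (real m / real d)"
  have reflection: "Gamma (real m / real d) * Gamma (real (d - m) / real d) = 2 * pi / (2 * sin (pi * real m / real d))"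
    if "m \<in> {1..<d}" for m
  proof -
    have "of_real (Gamma (real m / real d) * Gamma (1 - real m / real d))
        = (of_real (pi / sin (pi * (real m / real d))) :: complex)"
      using Gamma_reflection_complex[of "of_real (real m / real d)"]
      by (simp only: of_real_mult of_real_divide Gamma_complex_of_real[symmetric] sin_of_real[symmetric]
                     of_real_diff of_real_1)
    moreover have "1 - real m / real d = real (d - m) / real d"
      using that by (simp add: field_simps of_nat_diff)
    ultimately show ?thesis by (simp only: of_real_eq_iff) simp
  qed
  have "?G = (\<Prod>m=1..<d. Gamma (real (d - m) / real d))"
    by (rule prod.reindex_bij_witness[of _ "\<lambda>m. d - m" "\<lambda>m. d - m"]) auto
  then have "?G ^ 2 = (\<Prod>m=1..<d. Gamma (real m / real d) * Gamma (real (d - m) / real d))"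
    by (simp add: power2_eq_square prod.distrib)
  also have "\<dots> = (\<Prod>m=1..<d. 2 * pi / (2 * sin (pi * real m / real d)))"
    by (intro prod.cong reflection refl)
  also have "\<dots> = (2 * pi) ^ (d - 1) / real d"
    using prod_sin_multiples[OF assms] by (simp only: prod_dividef) simp
  finally have sq: "?G ^ 2 = (2 * pi) ^ (d - 1) / real d" .
  have "?G \<ge> 0"
    by (intro prod_nonneg ballI less_imp_le Gamma_real_pos) auto
  with sq have "?G = sqrt ((2 * pi) ^ (d - 1) / real d)"
    by (metis real_sqrt_unique)
  moreover have "(\<Prod>j<d. Gamma (real (Suc j) / real d)) = ?G"
  proof -
    have "(\<Prod>j<d. Gamma (real (Suc j) / real d)) = (\<Prod>m=1..d. Gamma (real m / real d))"
      by (rule prod.reindex_bij_witness[of _ "\<lambda>m. m - 1" Suc]) auto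
    also have "\<dots> = ?G"
      using assms by (cases d) (auto simp: atLeastLessThanSuc_atLeastAtMost Gamma_1 del: of_nat_Suc)
    finally show ?thesis .
  qed
  ultimately show ?thesis by simp
qed

definition radial_moment :: "nat \<Rightarrow> nat \<Rightarrow> real" where
  "radial_moment d j = real d powr (real (Suc j) / real d - 1) * Gamma (real (Suc j) / real d)"

text \<open>The substitution \<open>t = x\<^sup>d / d\<close> turns the integral into Euler's integral for the Gamma
  function. The half-line is open because the exponent of \<open>t\<close> may be negative.\<close>

lemma radial_moment_integral:
  assumes "d \<ge> 1"
  shows "(\<lambda>x. x ^ j * exp (- (x ^ d / real d))) absolutely_integrable_on {0::real<..}"
    and "integral {0<..} (\<lambda>x. x ^ j * exp (- (x ^ d / real d))) = radial_moment d j"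
proof -
  define \<alpha> where "\<alpha> = real (Suc j) / real d"
  have \<alpha>: "\<alpha> > 0" using assms by (simp add: \<alpha>_def)
  let ?g = "\<lambda>x. x ^ d / real d" and ?f = "\<lambda>t. t powr (\<alpha> - 1) / exp t"
  have image: "?g ` {0<..} = {0<..}"
  proof (intro equalityI subsetI)
    fix y :: real assume y: "y \<in> {0<..}"
    then have "?g (root d (real d * y)) = y" "root d (real d * y) > 0"
      using assms by simp_all
    then show "y \<in> ?g ` {0<..}" by (metis greaterThan_iff image_eqI)
  qed (use assms in auto)
  have "(?f has_integral Gamma \<alpha>) {0<..}"
    using Gamma_integral_real[OF \<alpha>]
    by (rule has_integral_spike_set_eq[THEN iffD1, rotated 2]) (auto intro: negligible_subset[of "{0}"])
  moreover from this have "?f absolutely_integrable_on {0<..}"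
    by (intro nonnegative_absolutely_integrable_1) (auto simp: has_integral_integrable)
  ultimately have "?f absolutely_integrable_on (?g ` {0<..}) \<and> integral (?g ` {0<..}) ?f = Gamma \<alpha>"
    by (simp add: image integral_unique)
  then have *: "(\<lambda>x. \<bar>x ^ (d - 1)\<bar> * ?f (?g x)) absolutely_integrable_on {0<..} \<and>
      integral {0<..} (\<lambda>x. \<bar>x ^ (d - 1)\<bar> * ?f (?g x)) = Gamma \<alpha>"
  proof (rule has_absolute_integral_change_of_variables_1'[THEN iffD2, rotated -1])
    show "(?g has_real_derivative x ^ (d - 1)) (at x within {0<..})" for x
      using assms by (auto intro!: derivative_eq_intros)
    show "inj_on ?g {0<..}"
      using assms by (auto intro!: inj_onI intro: power_eq_imp_eq_base[of _ d])
  qed auto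
  have eq: "x ^ j * exp (- ?g x) = real d powr (\<alpha> - 1) * (\<bar>x ^ (d - 1)\<bar> * ?f (?g x))" if "x \<in> {0<..}" for x
  proof -
    have x: "x > 0" using that by simp
    have "(x ^ d) powr (\<alpha> - 1) = x powr (real d * (\<alpha> - 1))"
      using x by (simp add: powr_powr flip: powr_realpow)
    also have "real d * (\<alpha> - 1) = real j - real (d - 1)"
      using assms by (simp add: \<alpha>_def field_simps of_nat_diff)
    also have "x powr (real j - real (d - 1)) = x ^ j / x ^ (d - 1)"
      using x by (simp add: powr_diff powr_realpow)
    finally have "x ^ (d - 1) * (x ^ d) powr (\<alpha> - 1) = x ^ j" using x by simp
    moreover have "(?g x) powr (\<alpha> - 1) = (x ^ d) powr (\<alpha> - 1) / real d powr (\<alpha> - 1)"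
      by (rule powr_divide)
    ultimately show ?thesis
      using x assms by (simp add: exp_minus field_simps)
  qed
  have "(\<lambda>x. real d powr (\<alpha> - 1) * (\<bar>x ^ (d - 1)\<bar> * ?f (?g x))) absolutely_integrable_on {0<..}"
    using * by (intro set_integrable_mult_right) auto
  then show "(\<lambda>x. x ^ j * exp (- (x ^ d / real d))) absolutely_integrable_on {0<..}"
    by (rule absolutely_integrable_spike[OF _ negligible_empty]) (simp only: eq Diff_empty)
  have "integral {0<..} (\<lambda>x. x ^ j * exp (- ?g x))
      = integral {0<..} (\<lambda>x. real d powr (\<alpha> - 1) * (\<bar>x ^ (d - 1)\<bar> * ?f (?g x)))"
    by (intro integral_cong eq)
  also have "\<dots> = real d powr (\<alpha> - 1) * Gamma \<alpha>"
    using * by (simp only: integral_mult_right)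
  also have "\<dots> = radial_moment d j"
    by (simp only: radial_moment_def \<alpha>_def)
  finally show "integral {0<..} (\<lambda>x. x ^ j * exp (- (x ^ d / real d))) = radial_moment d j" .
qed

text \<open>On the ray the integrand is a constant multiple of a real one, since \<open>w\<^sup>d = 1\<close>.\<close>

lemma ram_value_at_0:
  assumes d: "d \<ge> 1" and w: "w ^ d = 1"
  shows "ram_value (P0 d (\<lambda>_. 0)) j w = w ^ Suc j * of_real (radial_moment d j)"
proof -
  let ?h = "\<lambda>x. x ^ j * exp (- (x ^ d / real d))" and ?P = "P0 d (\<lambda>_. 0)"
  have F: "F ?P j (of_real r * w) = w ^ Suc j * of_real (integral {0..r} ?h)" if "r \<ge> 0" for r
  proof -
    have "((\<lambda>x. w * ((of_real x * w) ^ j * exp (poly ?P (of_real x * w)))) has_integral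
        F ?P j (of_real r * w) - F ?P j (of_real 0 * w)) {0..r}"
      using that by (intro fundamental_theorem_of_calculus F_along_ray) auto
    moreover have "w * ((of_real x * w) ^ j * exp (poly ?P (of_real x * w))) = w ^ Suc j * of_real (?h x)" for x
    proof -
      have "poly ?P (of_real x * w) = of_real (- (x ^ d / real d))"
        by (simp add: poly_P0 power_mult_distrib w)
      then show ?thesis by (simp only: exp_of_real) (simp add: power_mult_distrib)
    qed
    ultimately have "((\<lambda>x. w ^ Suc j * of_real (?h x)) has_integral F ?P j (of_real r * w)) {0..r}"
      by simp
    moreover have "((\<lambda>x. w ^ Suc j * of_real (?h x)) has_integral w ^ Suc j * of_real (integral {0..r} ?h)) {0..r}"
      by (intro has_integral_mult_right has_integral_of_real integrable_integral
            integrable_continuous_real continuous_intros) (use d in auto)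
    ultimately show ?thesis by (rule has_integral_unique)
  qed
  have abs: "?h absolutely_integrable_on {0..}"
    using radial_moment_integral(1)[OF d]
    by (rule absolutely_integrable_spike_set) (auto intro: negligible_subset[of "{0}"])
  then have sub: "?h absolutely_integrable_on {0..r}" for r
    by (rule set_integrable_subset) auto
  have "((\<lambda>r. set_lebesgue_integral lebesgue {0..r} ?h) \<longlongrightarrow> set_lebesgue_integral lebesgue {0..} ?h) at_top"
    by (rule tendsto_set_lebesgue_integral_at_top[OF _ abs]) auto
  then have "((\<lambda>r. integral {0..r} ?h) \<longlongrightarrow> integral {0..} ?h) at_top"
    using set_lebesgue_integral_eq_integral(2)[OF abs] set_lebesgue_integral_eq_integral(2)[OF sub] by simp
  also have "integral {0..} ?h = integral {0<..} ?h"
    by (rule integral_spike_set) (auto intro: negligible_subset[of "{0}"])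
  also have "\<dots> = radial_moment d j"
    by (rule radial_moment_integral(2)[OF d])
  finally have "((\<lambda>r. w ^ Suc j * of_real (integral {0..r} ?h)) \<longlongrightarrow> w ^ Suc j * of_real (radial_moment d j)) at_top"
    by (intro tendsto_intros)
  then have "((\<lambda>r. F ?P j (of_real r * w)) \<longlongrightarrow> w ^ Suc j * of_real (radial_moment d j)) at_top"
    by (rule Lim_transform_eventually[OF _ eventually_mono[OF eventually_ge_at_top[of 0]]]) (simp add: F)
  then show ?thesis
    using tendsto_unique[OF _ ram_value_tendsto[OF d w]] by simp
qed

lemma prod_radial_moment:
  assumes "d \<ge> 1"
  shows "(\<Prod>j<d. radial_moment d j) = (2 * pi / real d) powr (real d / 2) / sqrt (2 * pi)"
proof -
  have pos: "real d > 0" using assms by simp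
  have "(\<Prod>j<d. radial_moment d j) =
      (\<Prod>j<d. real d powr (real (Suc j) / real d - 1)) * sqrt ((2 * pi) ^ (d - 1) / real d)"
    using prod_Gamma_multiples[OF assms] by (simp only: radial_moment_def prod.distrib)
  also have "(\<Prod>j<d. real d powr (real (Suc j) / real d - 1)) = real d powr (\<Sum>j<d. real (Suc j) / real d - 1)"
    by (rule powr_sum[symmetric]) (use pos in simp)
  also have "(\<Sum>j<d. real (Suc j) / real d - 1) = (1 - real d) / 2"
  proof -
    have "(\<Sum>j<n. real (Suc j)) = real n * (real n + 1) / 2" for n
      by (induction n) (auto simp: field_simps)
    then show ?thesis
      using pos by (simp only: sum_subtractf sum_divide_distrib[symmetric]) (simp add: field_simps)
  qed
  also have "sqrt ((2 * pi) ^ (d - 1) / real d) = (2 * pi) powr ((real d - 1) / 2) * real d powr (- (1 / 2))"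
  proof -
    have "(2 * pi) ^ (d - 1) = (2 * pi) powr (real d - 1)"
      using assms powr_realpow[of "2 * pi" "d - 1"] by (simp add: of_nat_diff)
    then have num: "sqrt ((2 * pi) ^ (d - 1)) = (2 * pi) powr ((real d - 1) / 2)"
      using powr_half_sqrt[of "(2 * pi) powr (real d - 1)"] by (simp add: powr_powr)
    have den: "inverse (sqrt (real d)) = real d powr (- (1 / 2))"
      using powr_half_sqrt[of "real d"] by (simp add: powr_minus)
    show ?thesis
      by (simp only: real_sqrt_divide num den[symmetric] divide_inverse[of _ "sqrt (real d)"])
  qed
  also have "real d powr ((1 - real d) / 2) * ((2 * pi) powr ((real d - 1) / 2) * real d powr (- (1 / 2)))
      = (2 * pi) powr (real d / 2 - 1 / 2) * real d powr (- (real d / 2))"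
  proof -
    have "real d powr ((1 - real d) / 2) * real d powr (- (1 / 2)) = real d powr (- (real d / 2))"
      by (subst powr_add[symmetric]) (simp add: field_simps)
    then show ?thesis by (simp add: diff_divide_distrib)
  qed
  also have "\<dots> = (2 * pi / real d) powr (real d / 2) / sqrt (2 * pi)"
  proof -
    have "(2 * pi) powr (real d / 2 - 1 / 2) = (2 * pi) powr (real d / 2) / sqrt (2 * pi)"
      by (simp add: powr_diff powr_half_sqrt)
    moreover have "(2 * pi / real d) powr (real d / 2) = (2 * pi) powr (real d / 2) / real d powr (real d / 2)"
      by (rule powr_divide)
    ultimately show ?thesis by (simp only: powr_minus divide_inverse mult_ac)
  qed
  finally show ?thesis .
qed

section \<open>The ramificant\<close>

text \<open>The derivative of \<open>log \<Delta>\<close> in direction \<open>X\<^sub>m\<close> is the trace of the matrix that expresses the moments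
  shifted by \<open>m\<close> in terms of the basic ones. The exponent integrates this closed form along the
  ray from the origin; the factors \<open>X\<^sub>m\<close> are the velocity of the ray.\<close>

definition ramificant_exponent :: "nat \<Rightarrow> rat mpolynomial" where
  "ramificant_exponent d = (\<Sum>m<d. Poly_Mapping.single (Poly_Mapping.single m 1) 1 *
     radial_primitive (\<Sum>j<d. moment_coeff d (j + m) j))"

lemma mp_vars_ramificant_exponent: "mp_vars (ramificant_exponent d) \<subseteq> {..<d}"
  unfolding ramificant_exponent_def
proof (rule mp_vars_sum)
  fix m assume "m \<in> {..<d}"
  then have "mp_vars (Poly_Mapping.single (Poly_Mapping.single m 1) (1 :: rat)) \<subseteq> {..<d}"
    using mp_vars_single[of "Poly_Mapping.single m 1" "1 :: rat"] by auto
  moreover have "mp_vars (radial_primitive (\<Sum>j<d. moment_coeff d (j + m) j)) \<subseteq> {..<d}"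
    by (rule order_trans[OF mp_vars_radial_primitive]) (intro mp_vars_sum mp_vars_moment_coeff)
  ultimately show "mp_vars (Poly_Mapping.single (Poly_Mapping.single m 1) 1 *
     radial_primitive (\<Sum>j<d. moment_coeff d (j + m) j)) \<subseteq> {..<d}"
    using mp_vars_mult by blast
qed

lemma mp_eval_ramificant_exponent:
  "mp_eval (ramificant_exponent d) x =
     (\<Sum>m<d. x m * mp_eval (radial_primitive (\<Sum>j<d. moment_coeff d (j + m) j)) x)"
  by (simp only: ramificant_exponent_def mp_eval_sum mp_eval_single_mult monomial_value_var
                 of_rat_1 mult_1_left)

lemma mp_eval_ramificant_exponent_0 [simp]: "mp_eval (ramificant_exponent d) (\<lambda>_. 0) = 0"
  by (simp add: mp_eval_ramificant_exponent)

lemma DERIV_ramificant_exponent: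
  fixes a :: "nat \<Rightarrow> complex"
  shows "((\<lambda>t. mp_eval (ramificant_exponent d) (\<lambda>i. t * a i)) has_field_derivative
           (\<Sum>j<d. \<Sum>m<d. a m * mp_eval (moment_coeff d (j + m) j) (\<lambda>i. t * a i))) (at t)"
proof -
  let ?T = "\<lambda>m. \<Sum>j<d. moment_coeff d (j + m) j"
  have "((\<lambda>t. \<Sum>m<d. a m * (t * mp_eval (radial_primitive (?T m)) (\<lambda>i. t * a i)))
      has_field_derivative (\<Sum>m<d. a m * mp_eval (?T m) (\<lambda>i. t * a i))) (at t)"
    by (intro DERIV_sum DERIV_cmult DERIV_radial_primitive)
  moreover have "(\<Sum>m<d. a m * mp_eval (?T m) (\<lambda>i. t * a i)) =
      (\<Sum>j<d. \<Sum>m<d. a m * mp_eval (moment_coeff d (j + m) j) (\<lambda>i. t * a i))"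
    by (simp add: mp_eval_sum sum_distrib_left) (rule sum.swap)
  ultimately show ?thesis
    by (simp add: mp_eval_ramificant_exponent mult_ac)
qed

text \<open>Each column of the matrix of moments has as derivative a combination of all the columns, with
  coefficients common to all rows; the determinant therefore satisfies a scalar linear
  differential equation whose coefficient is the trace.\<close>

lemma DERIV_ramificant:
  fixes a :: "nat \<Rightarrow> complex"
  assumes d: "d \<ge> 1"
  shows "((\<lambda>t. ramificant d (\<lambda>i. t * a i)) has_field_derivative
           (\<Sum>j<d. \<Sum>m<d. a m * mp_eval (moment_coeff d (j + m) j) (\<lambda>i. t * a i))
             * ramificant d (\<lambda>i. t * a i)) (at t)"
proof -
  let ?P = "\<lambda>t. P0 d (\<lambda>i. t * a i)"
  define M where "M = (\<lambda>k j t. ram_value (?P t) j (omega d (Suc k)))"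
  define N where "N = (\<lambda>j i. \<Sum>m<d. a m * mp_eval (moment_coeff d (j + m) i) (\<lambda>i. t * a i))"
  note w = omega_power[OF d]
  have reduce: "M k n t = (\<Sum>i<d. mp_eval (moment_coeff d n i) (\<lambda>i. t * a i) * M k i t)" for k n
    unfolding M_def by (rule moment_coeff_recurrence[OF d]) (rule ram_value_recurrence[OF d w])
  have "(M k j has_field_derivative (\<Sum>i<d. N j i * M k i t)) (at t)" for k j
  proof -
    have "(M k j has_field_derivative (\<Sum>m<d. a m * M k (j + m) t)) (at t)"
      unfolding M_def by (rule DERIV_ram_value_parameter[OF d w])
    also have "(\<Sum>m<d. a m * M k (j + m) t) = (\<Sum>i<d. N j i * M k i t)"
      unfolding N_def sum_distrib_right
      by (subst sum.swap, intro sum.cong refl, subst reduce) (simp add: sum_distrib_left mult_ac)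
    finally show ?thesis .
  qed
  then have "((\<lambda>t. Determinant.det (Matrix.mat d d (\<lambda>(k, j). M k j t))) has_field_derivative
      (\<Sum>c<d. Determinant.det (Matrix.mat d d
         (\<lambda>(k, j). if j = c then (\<Sum>i<d. N j i * M k i t) else M k j t)))) (at t)"
    by (intro DERIV_det_columns)
  also have "(\<Sum>c<d. Determinant.det (Matrix.mat d d
         (\<lambda>(k, j). if j = c then (\<Sum>i<d. N j i * M k i t) else M k j t)))
      = (\<Sum>c<d. Determinant.det (Matrix.mat d d
         (\<lambda>(k, j). if j = c then (\<Sum>i<d. N c i * M k i t) else M k j t)))"
    by (intro sum.cong refl arg_cong[of _ _ Determinant.det] eq_matI) auto
  also have "\<dots> = (\<Sum>c<d. N c c) * Determinant.det (Matrix.mat d d (\<lambda>(k, j). M k j t))"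
    by (rule det_columns_combination)
  finally show ?thesis
    by (simp only: ramificant_def M_def N_def)
qed

lemma ramificant_eq_exp:
  assumes d: "d \<ge> 1"
  shows "ramificant d a = ramificant d (\<lambda>_. 0) * exp (mp_eval (ramificant_exponent d) a)"
proof -
  let ?D = "\<lambda>t. ramificant d (\<lambda>i. t * a i)" and ?E = "\<lambda>t. mp_eval (ramificant_exponent d) (\<lambda>i. t * a i)"
  have "((\<lambda>t. ?D t * exp (- ?E t)) has_field_derivative 0) (at t)" for t
    by (rule derivative_eq_intros DERIV_ramificant[OF d] DERIV_ramificant_exponent refl)+
       (simp add: algebra_simps)
  then obtain c where c: "\<And>t. ?D t * exp (- ?E t) = c"
    using has_field_derivative_zero_constant[of UNIV "\<lambda>t. ?D t * exp (- ?E t)"] by auto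
  have "ramificant d a * exp (- mp_eval (ramificant_exponent d) a) = ramificant d (\<lambda>_. 0)"
    using c[of 0] c[of 1] by simp
  then show ?thesis by (simp add: exp_minus field_simps)
qed

text \<open>The matrix at the origin is the Vandermonde matrix with its rows scaled by the roots of unity
  and its columns scaled by the radial moments.\<close>

lemma ramificant_at_0:
  assumes d: "d \<ge> 1"
  shows "ramificant d (\<lambda>_. 0) = (- 1) ^ (d - 1) / of_real (sqrt (2 * pi))
           * of_real ((2 * pi / real d) powr (real d / 2)) * vandermonde_roots d"
proof -
  have "ramificant d (\<lambda>_. 0) = Determinant.det (Matrix.mat d d
      (\<lambda>(k, j). omega d (Suc k) * of_real (radial_moment d j) * omega d (Suc k) ^ j))"
    by (simp add: ramificant_def ram_value_at_0[OF d omega_power[OF d]] mult_ac)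
  also have "\<dots> = (\<Prod>k<d. omega d (Suc k)) * (\<Prod>j<d. of_real (radial_moment d j)) * vandermonde_roots d"
    unfolding vandermonde_roots_def by (rule det_scale_rows_columns)
  also have "\<dots> = (- 1) ^ (d - 1) * of_real ((2 * pi / real d) powr (real d / 2) / sqrt (2 * pi)) * vandermonde_roots d"
    by (simp only: prod_omega[OF d] prod_radial_moment[OF d] of_real_prod[symmetric])
  finally show ?thesis by simp
qed

lemma ramificant_at_0_explicit:
  assumes d: "d \<ge> 1"
  shows "ramificant d (\<lambda>_. 0) = \<i> ^ ((d - 1) * (3 * d + 2) div 2) / of_real (sqrt (2 * pi))
               * of_real ((2 * pi) powr (real d / 2))"
proof -
  have phase: "(- 1) ^ (d - 1) * \<i> ^ ((d - 1) * (3 * d - 2) div 2) = \<i> ^ ((d - 1) * (3 * d + 2) div 2)"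
  proof -
    obtain n where n: "d = Suc n" using d by (cases d) auto
    have "2 * (d - 1) + (d - 1) * (3 * d - 2) div 2 = (d - 1) * (3 * d + 2) div 2"
      by (simp add: n algebra_simps)
    moreover have "(- 1) ^ (d - 1) = \<i> ^ (2 * (d - 1))" by (simp add: power_mult)
    ultimately show ?thesis by (simp only: power_add[symmetric])
  qed
  have modulus: "(2 * pi / real d) powr (real d / 2) * real d powr (real d / 2) = (2 * pi) powr (real d / 2)"
    using d by (simp add: powr_divide)
  show ?thesis
    unfolding ramificant_at_0[OF d] vandermonde_roots_value[OF d] phase[symmetric] modulus[symmetric] of_real_mult
    by (simp only: divide_inverse mult_ac)
qed

theorem mainTheorem15:
  fixes d :: nat
  assumes "d \<ge> 1"
  shows
    "(\<exists>p :: rat mpolynomial.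
        mp_vars p \<subseteq> {..<d} \<and>
        mp_eval p (\<lambda>_. 0 :: rat) = 0 \<and>
        (\<forall>a :: nat \<Rightarrow> complex.
           (\<forall>j<d. \<forall>k\<in>{1..d}.
              ((\<lambda>r::real. F (P0 d a) j (of_real r * omega d k))
                 \<longlongrightarrow> ram_value (P0 d a) j (omega d k)) at_top) \<and>
           ramificant d a =
             (- 1) ^ (d - 1) / of_real (sqrt (2 * pi)) * of_real ((2 * pi / real d) powr (real d / 2))
               * vandermonde_roots d * exp (mp_eval p a) \<and>
           ramificant d a \<noteq> 0 \<and>
           ramificant d a =
             \<i> ^ ((d - 1) * (3 * d + 2) div 2) / of_real (sqrt (2 * pi))
               * of_real ((2 * pi) powr (real d / 2)) * exp (mp_eval p a)))
     \<and> vandermonde_roots d = (\<Prod>(i, j)\<in>{(i, j). 1 \<le> i \<and> i < j \<and> j \<le> d}. omega d j - omega d i)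
     \<and> vandermonde_roots d \<noteq> 0
     \<and> (\<Prod>(i, j)\<in>{(i, j). i \<in> {1..d} \<and> j \<in> {1..d} \<and> i \<noteq> j}. omega d i - omega d j)
         = (- 1) ^ (d - 1) * of_nat d ^ d
     \<and> vandermonde_roots d =
         \<i> ^ ((d - 1) * (3 * d - 2) div 2) * of_real (real d powr (real d / 2))"
proof -
  note d = \<open>d \<ge> 1\<close>
  let ?p = "ramificant_exponent d"
  have "((\<lambda>r::real. F (P0 d a) j (of_real r * omega d k)) \<longlongrightarrow> ram_value (P0 d a) j (omega d k)) at_top"
    if "k \<in> {1..d}" for a j k
  proof -
    from that obtain l where "k = Suc l" by (cases k) auto
    then show ?thesis using ram_value_tendsto[OF d omega_power[OF d]] by simp
  qed
  moreover have "ramificant d a = (- 1) ^ (d - 1) / of_real (sqrt (2 * pi)) * of_real ((2 * pi / real d) powr (real d / 2))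
      * vandermonde_roots d * exp (mp_eval ?p a)" for a
    using ramificant_eq_exp[OF d, of a] by (simp only: ramificant_at_0[OF d])
  moreover have explicit: "ramificant d a = \<i> ^ ((d - 1) * (3 * d + 2) div 2) / of_real (sqrt (2 * pi))
      * of_real ((2 * pi) powr (real d / 2)) * exp (mp_eval ?p a)" for a
    using ramificant_eq_exp[OF d, of a] by (simp only: ramificant_at_0_explicit[OF d])
  moreover have "ramificant d a \<noteq> 0" for a
    unfolding explicit by simp
  ultimately have "\<exists>p :: rat mpolynomial.
        mp_vars p \<subseteq> {..<d} \<and>
        mp_eval p (\<lambda>_. 0 :: rat) = 0 \<and>
        (\<forall>a :: nat \<Rightarrow> complex.
           (\<forall>j<d. \<forall>k\<in>{1..d}.
              ((\<lambda>r::real. F (P0 d a) j (of_real r * omega d k))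
                 \<longlongrightarrow> ram_value (P0 d a) j (omega d k)) at_top) \<and>
           ramificant d a =
             (- 1) ^ (d - 1) / of_real (sqrt (2 * pi)) * of_real ((2 * pi / real d) powr (real d / 2))
               * vandermonde_roots d * exp (mp_eval p a) \<and>
           ramificant d a \<noteq> 0 \<and>
           ramificant d a =
             \<i> ^ ((d - 1) * (3 * d + 2) div 2) / of_real (sqrt (2 * pi))
               * of_real ((2 * pi) powr (real d / 2)) * exp (mp_eval p a))"
    by (intro exI[of _ ?p] conjI mp_vars_ramificant_exponent mp_eval_ramificant_exponent_0 allI impI ballI)
  moreover have "vandermonde_roots d \<noteq> 0"
    using d by (simp add: vandermonde_roots_value)
  ultimately show ?thesis
    using vandermonde_roots_eq_pairs prod_omega_pairs[OF d] vandermonde_roots_value[OF d]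
    by (intro conjI)
qed

end
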